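(* Assume the Weak Hardy-Littlewood Goldbach Conjecture with a given fixed $0<\delta<1$. For $q$ sufficiently large suppose $\chi_1$ is a real character modulo $q$ for which $L(s,\chi_1)$ has a real zero $\beta_1$ with $1 - c/\log q<\beta_1$ for a positive constant $c$. Let $c_1$ be the positive constant in the prime number theorem for arithmetic progressions stated below. Then for any fixed positive constant $c'<c_1$ we have \[ \beta_1 < 1 - \frac{\frac12(c')^2\log(\frac{1}{1-\delta})}{\log^2q}. \]
   Context: $\Lambda$ is the von Mangoldt function and $\psi_2(n) = \sum_{m+m'=n} \Lambda(m)\Lambda(m')$ (sum over positive integers $m,m'$). The singular series is $\mathfrak{S}(k) = 2 C_{2} \prod_{p \mid k,\, p > 2} \frac{p - 1}{p - 2}$ if $k$ is even, $k\neq 0$, and $\mathfrak{S}(k)=0$ if $k$ is odd, where $C_{2} = \prod_{p > 2} \left( 1 - \frac{1}{(p - 1)^{2}}\right)$. The Weak Hardy-Littlewood Goldbach Conjecture with parameter $\delta$ ($0<\delta<1$ fixed) asserts that for all sufficiently large even $n$, $\delta \mathfrak{S}(n) n \le \psi_2(n) \le (2-\delta)\mathfrak{S}(n) n$. The prime number theorem for arithmetic progressions used: with $\psi(x;q,a) = \sum_{n\le x,\, n\equiv a \,(\mathrm{mod}\, q)}\Lambda(n)$, there is a positive absolute constant $c_1$ such that for $(a,q)=1$, $\psi(x;q,a) = \frac{x}{\phi(q)} - \frac{\chi_1(a)x^{\beta_1}}{\phi(q) \beta_1} + O(xe^{-c_1\sqrt{\log x}})$, where $\chi_1$, $\beta_1$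 refer to the possible exceptional real character modulo $q$ and its real zero (the term is omitted if no such exceptional zero exists). *)

theory Defs
  imports
    "HOL-Complex_Analysis.Complex_Analysis"
    "HOL-Number_Theory.Number_Theory"
    "HOL-Number_Theory.Prime_Powers"
begin

definition psi2 :: "nat \<Rightarrow> real" where
  "psi2 n = (\<Sum>(m, m') \<in> {(m, m'). 0 < m \<and> 0 < m' \<and> m + m' = n}. mangoldt m * mangoldt m')"

definition twin_prime_const :: real where
  "twin_prime_const = (\<Prod>p. if prime p \<and> p > 2 then 1 - 1 / (real p - 1)\<^sup>2 else 1)"

definition singular_series :: "nat \<Rightarrow> real" where
  "singular_series k =
     (if even k \<and> k \<noteq> 0
      then 2 * twin_prime_const *
             (\<Prod>p \<in> {p. prime p \<and> p dvd k \<and> p > 2}. (real p - 1) / (real p - 2))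
      else 0)"

definition weak_HL_Goldbach :: "real \<Rightarrow> bool" where
  "weak_HL_Goldbach \<delta> \<longleftrightarrow>
     (\<forall>\<^sub>F n in sequentially. even n \<longrightarrow>
        \<delta> * singular_series n * real n \<le> psi2 n \<and>
        psi2 n \<le> (2 - \<delta>) * singular_series n * real n)"

definition dirichlet_character :: "nat \<Rightarrow> (nat \<Rightarrow> complex) \<Rightarrow> bool" where
  "dirichlet_character q X \<longleftrightarrow> q > 0 \<and>
     (\<forall>m n. X (m * n) = X m * X n) \<and>
     (\<forall>n. X (n + q) = X n) \<and>
     (\<forall>n. X n = 0 \<longleftrightarrow> \<not> coprime n q)"

definition real_dirichlet_character :: "nat \<Rightarrow> (nat \<Rightarrow> complex) \<Rightarrow> bool" where
  "real_dirichlet_character q X \<longleftrightarrow> dirichlet_character q X \<and> range X \<subseteq> \<real>"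

definition principal_character :: "nat \<Rightarrow> (nat \<Rightarrow> complex) \<Rightarrow> bool" where
  "principal_character q X \<longleftrightarrow>
     dirichlet_character q X \<and> (\<forall>n. coprime n q \<longrightarrow> X n = 1)"

text \<open>
  For the principal character, the only singularity of the L-function is the simple pole at 1.
\<close>

definition dirichlet_L_domain :: "nat \<Rightarrow> (nat \<Rightarrow> complex) \<Rightarrow> complex set" where
  "dirichlet_L_domain q X = (if principal_character q X then - {1} else UNIV)"

text \<open>
  The analytic continuation of the Dirichlet series. It is uniquely determined on
  \<^const>\<open>dirichlet_L_domain\<close>; its value at the pole of a principal character is unspecified,
  which is why a zero is required to lie in the domain.
\<close>

definition dirichlet_L :: "nat \<Rightarrow> (nat \<Rightarrow> complex) \<Rightarrow> complex \<Rightarrow> complex" where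
  "dirichlet_L q X =
     (SOME f. f holomorphic_on dirichlet_L_domain q X \<and>
        (\<forall>s. Re s > 1 \<longrightarrow> (\<lambda>n. X (Suc n) / of_nat (Suc n) powr s) sums f s))"

definition dirichlet_L_zero :: "nat \<Rightarrow> (nat \<Rightarrow> complex) \<Rightarrow> complex \<Rightarrow> bool" where
  "dirichlet_L_zero q X s \<longleftrightarrow> s \<in> dirichlet_L_domain q X \<and> dirichlet_L q X s = 0"

definition exceptional_zero :: "real \<Rightarrow> nat \<Rightarrow> (nat \<Rightarrow> complex) \<Rightarrow> real \<Rightarrow> bool" where
  "exceptional_zero c q X \<beta> \<longleftrightarrow>
     real_dirichlet_character q X \<and> dirichlet_L_zero q X (complex_of_real \<beta>) \<and>
     1 - c / ln (real q) < \<beta>"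

definition psi_AP :: "real \<Rightarrow> nat \<Rightarrow> nat \<Rightarrow> real" where
  "psi_AP x q a = (\<Sum>n \<in> {n. 1 \<le> n \<and> real n \<le> x \<and> [n = a] (mod q)}. mangoldt n)"

text \<open>
  \<open>c\<^sub>1\<close> is an admissible constant in the prime number theorem for arithmetic progressions. The
  implied constant \<open>K\<close> is uniform in \<open>x\<close>, \<open>q\<close> and \<open>a\<close>. The constant \<open>c\<^sub>0\<close> is the
  one in the notion of an exceptional zero; for small \<open>c\<^sub>0\<close> each modulus has at most one
  exceptional pair \<open>(X\<^sub>1, \<beta>\<^sub>1)\<close>, and \<open>X\<^sub>1\<close> is real-valued, so that
  taking the real part only changes the type.
\<close>

definition PNT_AP_const :: "real \<Rightarrow> bool" where
  "PNT_AP_const c\<^sub>1 \<longleftrightarrow> c\<^sub>1 > 0 \<and>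
     (\<exists>c\<^sub>0>0. \<exists>K. \<forall>x\<ge>2. \<forall>q>0. \<forall>a. coprime a q \<longrightarrow>
        (\<forall>X\<^sub>1 \<beta>\<^sub>1. exceptional_zero c\<^sub>0 q X\<^sub>1 \<beta>\<^sub>1 \<longrightarrow>
           \<bar>psi_AP x q a -
              (x / real (totient q) - Re (X\<^sub>1 a) * x powr \<beta>\<^sub>1 / (real (totient q) * \<beta>\<^sub>1))\<bar>
             \<le> K * (x * exp (- c\<^sub>1 * sqrt (ln x)))) \<and>
        ((\<nexists>X\<^sub>1 \<beta>\<^sub>1. exceptional_zero c\<^sub>0 q X\<^sub>1 \<beta>\<^sub>1) \<longrightarrow>
           \<bar>psi_AP x q a - x / real (totient q)\<bar>
             \<le> K * (x * exp (- c\<^sub>1 * sqrt (ln x)))))"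

end

theory Submission
  imports Defs "HOL-Real_Asymp.Real_Asymp"
begin

text \<open>
  Sum \<open>\<psi>\<^sub>2(n)\<close> over the multiples \<open>n \<le> N\<close> of \<open>q\<close>, where \<open>log N\<close> is about
  \<open>(log q / d)\<^sup>2\<close> with \<open>c' < d < c\<^sub>1\<close>. Sorting the pairs by residue class and using the prime
  number theorem, this sum is about \<open>N\<^sup>2 / (2 \<phi>(q))\<close> times the mean of
  \<open>(1 - X\<^sub>1(a) Y) (1 - X\<^sub>1(-a) Y)\<close> over the reduced residues \<open>a\<close>, with \<open>Y = N\<close> to the power
  \<open>\<beta>\<^sub>1 - 1\<close>. The mean is \<open>1 - Y\<^sup>2\<close> for odd \<open>X\<^sub>1\<close>, \<open>1 + Y\<^sup>2\<close> for even nonprincipal \<open>X\<^sub>1\<close>, and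
  \<open>(1 - Y)\<^sup>2\<close> for principal \<open>X\<^sub>1\<close>. The singular series satisfies
  \<open>\<Sum> \<SS>(n) n \<sim> N\<^sup>2 / (2 \<phi>(q))\<close> over the same \<open>n\<close>, so the conjecture forces the mean to lie
  between \<open>\<delta> - o(1)\<close> and \<open>2 - \<delta> + o(1)\<close>; in every case \<open>Y\<^sup>2 \<le> 1 - \<delta> + o(1)\<close>, which is the
  claim. The zero \<open>\<beta>\<^sub>1\<close> enters only through the prime number theorem, so nothing about L-functions
  is needed; in particular \<open>\<beta>\<^sub>1 \<le> 1\<close> follows from \<open>\<psi>(x;q,1) \<ge> 0\<close> as \<open>x \<rightarrow> \<infinity>\<close>.
\<close>

section \<open>Partial summation and sums of the von Mangoldt function\<close>

text \<open>Abel summation: the weight \<open>N - m\<close> counts the \<open>u\<close> with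
  \<open>m \<le> u < N\<close>.\<close>

lemma sum_mult_diff_eq_sum_partial_sums:
  fixes f :: "nat \<Rightarrow> real"
  shows "(\<Sum>m\<le>N. f m * (real N - real m)) = (\<Sum>u<N. \<Sum>m\<le>u. f m)"
proof (induction N)
  case (Suc N)
  have "(\<Sum>m\<le>Suc N. f m * (real (Suc N) - real m))
      = (\<Sum>m\<le>N. f m * (real N - real m)) + (\<Sum>m\<le>N. f m)"
    unfolding atMost_Suc by (simp add: sum.distrib [symmetric] algebra_simps)
  then show ?case by (simp add: Suc)
qed simp

text \<open>The term \<open>\<bar>\<alpha>\<bar> * N / 2\<close> is the gap between
  \<open>N^2 / 2\<close> and the sum of all \<open>u < N\<close>, scaled by \<open>\<alpha>\<close>;
  the rest is \<open>N\<close> errors of size \<open>e\<close>.\<close>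

lemma sum_partial_sums_approx:
  fixes f :: "nat \<Rightarrow> real"
  assumes "\<And>u. u \<le> N \<Longrightarrow> \<bar>(\<Sum>m\<le>u. f m) - \<alpha> * real u\<bar> \<le> e"
  shows "\<bar>(\<Sum>u<N. \<Sum>m\<le>u. f m) - \<alpha> * (real N)\<^sup>2 / 2\<bar> \<le> \<bar>\<alpha>\<bar> * real N / 2 + real N * e"
proof -
  have s: "(\<Sum>u<N. \<alpha> * real u) = \<alpha> * (real N)\<^sup>2 / 2 - \<alpha> * real N / 2"
    by (induction N) (simp_all add: field_simps power2_eq_square)
  have "\<bar>\<Sum>u<N. (\<Sum>m\<le>u. f m) - \<alpha> * real u\<bar> \<le> (\<Sum>u<N. \<bar>(\<Sum>m\<le>u. f m) - \<alpha> * real u\<bar>)"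
    by (rule sum_abs)
  also have "\<dots> \<le> (\<Sum>u<N. e)"
    by (intro sum_mono assms) auto
  finally have "\<bar>(\<Sum>u<N. \<Sum>m\<le>u. f m) - (\<Sum>u<N. \<alpha> * real u)\<bar> \<le> real N * e"
    by (simp add: sum_subtractf)
  moreover have "\<bar>\<alpha> * real N / 2\<bar> = \<bar>\<alpha>\<bar> * real N / 2" by (simp add: abs_mult)
  ultimately show ?thesis unfolding s by linarith
qed

text \<open>Writing \<open>m = N - (N - m)\<close>, the full sum and the sum of partial sums each
  cost \<open>N * e\<close>. This later attaches the weight \<open>n\<close> to the singular
  series.\<close>

lemma sum_weighted_approx:
  fixes f :: "nat \<Rightarrow> real"
  assumes "\<And>u. u \<le> N \<Longrightarrow> \<bar>(\<Sum>m\<le>u. f m) - \<alpha> * real u\<bar> \<le> e"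
  shows "\<bar>(\<Sum>m\<le>N. f m * real m) - \<alpha> * (real N)\<^sup>2 / 2\<bar> \<le> \<bar>\<alpha>\<bar> * real N / 2 + 2 * real N * e"
proof -
  have "(\<Sum>m\<le>N. f m * real m) = real N * (\<Sum>m\<le>N. f m) - (\<Sum>u<N. \<Sum>m\<le>u. f m)"
    unfolding sum_mult_diff_eq_sum_partial_sums [symmetric]
    by (simp add: sum_distrib_left sum_subtractf algebra_simps)
  moreover have "\<bar>real N * ((\<Sum>m\<le>N. f m) - \<alpha> * real N)\<bar> \<le> real N * e"
    unfolding abs_mult by (intro mult_mono assms) auto
  ultimately show ?thesis
    using sum_partial_sums_approx[of N f \<alpha> e, OF assms]
    by (simp add: power2_eq_square algebra_simps)
qed

text \<open>Replacing each inner sum by \<open>\<gamma> * (N - m)\<close> costs \<open>e\<close>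
  times the total mass of \<open>f\<close>, which for nonnegative \<open>f\<close> is at most
  \<open>\<alpha> * N + e\<close>; a sum of partial sums of \<open>f\<close> remains. The intended
  \<open>f\<close> and \<open>g\<close> belong to the residue classes of \<open>a\<close> and
  \<open>-a\<close>.\<close>

lemma sum_convolution_approx:
  fixes f g :: "nat \<Rightarrow> real"
  assumes f: "\<And>m. 0 \<le> f m" and "0 \<le> \<alpha>" "0 \<le> \<gamma>" "0 \<le> e"
    and F: "\<And>u. u \<le> N \<Longrightarrow> \<bar>(\<Sum>m\<le>u. f m) - \<alpha> * real u\<bar> \<le> e"
    and G: "\<And>u. u \<le> N \<Longrightarrow> \<bar>(\<Sum>m\<le>u. g m) - \<gamma> * real u\<bar> \<le> e"
  shows "\<bar>(\<Sum>m\<le>N. f m * (\<Sum>k\<le>N - m. g k)) - \<alpha> * \<gamma> * (real N)\<^sup>2 / 2\<bar>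
           \<le> \<gamma> * (\<alpha> * real N / 2 + real N * e) + e * (\<alpha> * real N + e)"
proof -
  have "\<bar>\<Sum>m\<le>N. f m * ((\<Sum>k\<le>N - m. g k) - \<gamma> * real (N - m))\<bar>
      \<le> (\<Sum>m\<le>N. \<bar>f m * ((\<Sum>k\<le>N - m. g k) - \<gamma> * real (N - m))\<bar>)"
    by (rule sum_abs)
  also have "\<dots> \<le> (\<Sum>m\<le>N. f m * e)"
    unfolding abs_mult using f by (intro sum_mono mult_mono G) auto
  also have "\<dots> = e * (\<Sum>m\<le>N. f m)" by (simp add: sum_distrib_left mult.commute)
  also have "\<dots> \<le> e * (\<alpha> * real N + e)"
    using F[of N] \<open>0 \<le> e\<close> by (intro mult_left_mono) auto
  also have "(\<Sum>m\<le>N. f m * ((\<Sum>k\<le>N - m. g k) - \<gamma> * real (N - m))) =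
      (\<Sum>m\<le>N. f m * (\<Sum>k\<le>N - m. g k)) - \<gamma> * (\<Sum>m\<le>N. f m * (real N - real m))"
    by (simp add: sum_distrib_left [of \<gamma>] sum_subtractf [symmetric] of_nat_diff right_diff_distrib
        mult.left_commute)
  finally have 1: "\<bar>(\<Sum>m\<le>N. f m * (\<Sum>k\<le>N - m. g k)) - \<gamma> * (\<Sum>u<N. \<Sum>m\<le>u. f m)\<bar>
      \<le> e * (\<alpha> * real N + e)"
    unfolding sum_mult_diff_eq_sum_partial_sums .
  have "\<bar>\<gamma> * ((\<Sum>u<N. \<Sum>m\<le>u. f m) - \<alpha> * (real N)\<^sup>2 / 2)\<bar> \<le> \<gamma> * (\<alpha> * real N / 2 + real N * e)"
    unfolding abs_mult using sum_partial_sums_approx[of N f \<alpha> e, OF F] assms(2,3)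
    by (intro mult_mono) auto
  with 1 show ?thesis by (simp add: algebra_simps)
qed

section \<open>Crude bounds for sums of \<open>mangoldt\<close>\<close>

text \<open>Among the multiples of \<open>p\<close>, \<open>mangoldt\<close> lives on the powers of
  \<open>p\<close>; at most \<open>ln N / ln p\<close> of them are \<open>\<le> N\<close>, each of
  weight \<open>ln p\<close>.\<close>

lemma sum_mangoldt_dvd_le:
  assumes "prime p" "N > 0"
  shows "(\<Sum>n | n \<le> N \<and> p dvd n. mangoldt n :: real) \<le> ln (real N)"
proof -
  have p1: "real p > 1" using prime_gt_1_nat[OF assms(1)] by simp
  define K where "K = nat \<lfloor>ln (real N) / ln (real p)\<rfloor>"
  have "(\<Sum>n | n \<le> N \<and> p dvd n. mangoldt n :: real) = (\<Sum>n | n \<le> N \<and> p dvd n \<and> primepow n. mangoldt n)"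
    by (rule sum.mono_neutral_right) (auto simp: mangoldt_def)
  also have "\<dots> \<le> (\<Sum>n\<in>(\<lambda>k. p ^ k) ` {1..K}. mangoldt n)"
  proof (rule sum_mono2)
    show "{n. n \<le> N \<and> p dvd n \<and> primepow n} \<subseteq> (\<lambda>k. p ^ k) ` {1..K}"
    proof safe
      fix n assume n: "n \<le> N" "p dvd n" "primepow n"
      then obtain r k where rk: "prime r" "k > 0" "n = r ^ k" by (auto simp: primepow_def)
      with n assms(1) have "r = p" using prime_dvd_power primes_dvd_imp_eq by blast
      with rk n(1) have "real p ^ k \<le> real N" by (metis of_nat_le_iff of_nat_power)
      then have "real k * ln (real p) \<le> ln (real N)"
        using p1 assms(2) by (subst ln_realpow [symmetric]) (auto simp del: ln_realpow)
      then have "real k \<le> ln (real N) / ln (real p)" using p1 by (simp add: field_simps)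
      then have "k \<le> K" unfolding K_def by linarith
      with rk \<open>r = p\<close> show "n \<in> (\<lambda>k. p ^ k) ` {1..K}" by auto
    qed
  qed (auto simp: mangoldt_nonneg)
  also have "\<dots> = (\<Sum>k\<in>{1..K}. mangoldt (p ^ k))"
    using prime_gt_1_nat[OF assms(1)] by (subst sum.reindex) (auto simp: inj_on_def)
  also have "\<dots> = (\<Sum>k\<in>{1..K}. ln (real p))"
    using assms(1) by (intro sum.cong) auto
  also have "\<dots> = real K * ln (real p)" by simp
  also have "\<dots> \<le> ln (real N) / ln (real p) * ln (real p)"
    using p1 assms(2) unfolding K_def by (intro mult_right_mono) auto
  finally show ?thesis using p1 by simp
qed

lemma sum_UN_le:
  fixes f :: "'a \<Rightarrow> real"
  assumes "finite I" "\<And>i. i \<in> I \<Longrightarrow> finite (A i)" "\<And>x. 0 \<le> f x"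
  shows "sum f (\<Union>i\<in>I. A i) \<le> (\<Sum>i\<in>I. sum f (A i))"
  using assms(1,2)
proof (induction I rule: finite_induct)
  case (insert i I)
  have "sum f (\<Union>i\<in>insert i I. A i) \<le> sum f (A i) + sum f (\<Union>i\<in>I. A i)"
    using insert.prems insert.hyps assms(3) by (simp add: sum_Un sum_nonneg)
  also have "\<dots> \<le> sum f (A i) + (\<Sum>i\<in>I. sum f (A i))"
    using insert by simp
  finally show ?case using insert.hyps by simp
qed simp

text \<open>Union bound over the prime factors of \<open>d\<close>, of which there are at most
  \<open>d\<close>.\<close>

lemma sum_mangoldt_not_coprime_le:
  assumes "d > 0" "N > 0"
  shows "(\<Sum>n | n \<le> N \<and> \<not> coprime n d. mangoldt n :: real) \<le> real d * ln (real N)"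
proof -
  have "(\<Sum>n | n \<le> N \<and> \<not> coprime n d. mangoldt n :: real)
      \<le> (\<Sum>n\<in>(\<Union>p\<in>prime_factors d. {n. n \<le> N \<and> p dvd n}). mangoldt n)"
  proof (rule sum_mono2)
    show "{n. n \<le> N \<and> \<not> coprime n d} \<subseteq> (\<Union>p\<in>prime_factors d. {n. n \<le> N \<and> p dvd n})"
    proof safe
      fix n assume "n \<le> N" "\<not> coprime n d"
      then obtain p where "prime p" "p dvd gcd n d"
        by (metis coprime_iff_gcd_eq_1 prime_factor_nat)
      with \<open>n \<le> N\<close> assms(1) show "n \<in> (\<Union>p\<in>prime_factors d. {n. n \<le> N \<and> p dvd n})"
        by (auto simp: in_prime_factors_iff)
    qed
  qed (auto simp: mangoldt_nonneg)
  also have "\<dots> \<le> (\<Sum>p\<in>prime_factors d. \<Sum>n | n \<le> N \<and> p dvd n. mangoldt n)"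
    by (rule sum_UN_le) (auto simp: mangoldt_nonneg)
  also have "\<dots> \<le> (\<Sum>p\<in>prime_factors d. ln (real N))"
    using assms(2) by (intro sum_mono sum_mangoldt_dvd_le) auto
  also have "\<dots> \<le> real d * ln (real N)"
  proof -
    have "prime_factors d \<subseteq> {1..d}"
      using assms(1) by (auto simp: in_prime_factors_iff dvd_imp_le Suc_le_eq prime_gt_0_nat)
    from card_mono[OF _ this] have "real (card (prime_factors d)) \<le> real d" by simp
    with assms(2) show ?thesis by (simp add: mult_right_mono)
  qed
  finally show ?thesis .
qed

text \<open>The trivial bound \<open>ln N\<close> per term is enough: the sum only enters error
  terms, where a logarithm is harmless.\<close>

lemma sum_mangoldt_le:
  assumes "N > 0"
  shows "(\<Sum>n\<le>N. mangoldt n :: real) \<le> real N * ln (real N)"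
proof -
  have "(\<Sum>n\<le>N. mangoldt n :: real) = (\<Sum>n\<in>{1..N}. mangoldt n)"
    by (rule sum.mono_neutral_right) (auto simp: not_le)
  also have "\<dots> \<le> (\<Sum>n\<in>{1..N}. ln (real N))"
    by (intro sum_mono order.trans[OF mangoldt_le]) auto
  finally show ?thesis by simp
qed

section \<open>The mean value of the singular series over multiples\<close>

lemma prod_one_plus_eq_sum_Pow:
  fixes f :: "'a \<Rightarrow> real"
  assumes "finite P"
  shows "(\<Prod>p\<in>P. 1 + f p) = (\<Sum>A\<in>Pow P. \<Prod>p\<in>A. f p)"
  using prod_add[OF assms, of f "\<lambda>_. 1"] by (simp add: add.commute)

lemma prod_primes_dvd_iff:
  fixes k :: nat
  assumes "finite A" "\<And>p. p \<in> A \<Longrightarrow> prime p"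
  shows "\<Prod>A dvd k \<longleftrightarrow> (\<forall>p\<in>A. p dvd k)"
  using assms
proof (induction A rule: finite_induct)
  case (insert p A)
  have "coprime p (\<Prod>A)"
    using insert by (intro prod_coprime_right primes_coprime) auto
  then have "p * \<Prod>A dvd k \<longleftrightarrow> p dvd k \<and> \<Prod>A dvd k"
    by (meson divides_mult dvd_mult_left dvd_mult_right)
  then show ?case using insert by simp
qed simp

lemma card_multiples:
  assumes "d > 0"
  shows "card {k\<in>{1..M}. d dvd k} = M div d"
proof -
  have "{k\<in>{1..M}. d dvd k} = (\<lambda>j. d * j) ` {1..M div d}"
    using assms by (force simp: div_le_mono less_eq_div_iff_mult_less_eq mult.commute elim!: dvdE)
  also have "card \<dots> = M div d"
    using assms by (subst card_image) (auto simp: inj_on_def)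
  finally show ?thesis .
qed

text \<open>Expand the product over the sets \<open>A\<close> of primes dividing \<open>k\<close>
  and exchange the sums: \<open>A\<close> occurs for the multiples \<open>k\<close> of
  \<open>\<Prod>A\<close>, and there are \<open>M div \<Prod>A\<close> of them.\<close>

lemma sum_prod_primes_dvd:
  fixes f :: "nat \<Rightarrow> real"
  assumes "finite P" "\<And>p. p \<in> P \<Longrightarrow> prime p"
  shows "(\<Sum>k=1..M. \<Prod>p\<in>{p\<in>P. p dvd k}. 1 + f p) = (\<Sum>A\<in>Pow P. (\<Prod>p\<in>A. f p) * real (M div \<Prod>A))"
proof -
  have "(\<Prod>p\<in>{p\<in>P. p dvd k}. 1 + f p) = (\<Sum>A\<in>Pow P. if \<Prod>A dvd k then \<Prod>p\<in>A. f p else 0)" for k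
  proof -
    have "(\<Prod>p\<in>{p\<in>P. p dvd k}. 1 + f p) = (\<Sum>A\<in>Pow {p\<in>P. p dvd k}. \<Prod>p\<in>A. f p)"
      using assms(1) by (intro prod_one_plus_eq_sum_Pow) auto
    also have "\<dots> = (\<Sum>A\<in>Pow P. if \<Prod>A dvd k then \<Prod>p\<in>A. f p else 0)"
    proof (rule sum.mono_neutral_cong_left)
      have *: "\<Prod>A dvd k \<longleftrightarrow> (\<forall>p\<in>A. p dvd k)" if "A \<subseteq> P" for A
        using assms that by (intro prod_primes_dvd_iff) (auto intro: finite_subset)
      show "\<forall>A\<in>Pow P - Pow {p \<in> P. p dvd k}. (if \<Prod>A dvd k then prod f A else 0) = 0"
        by (auto simp: *)
      fix A assume "A \<in> Pow {p \<in> P. p dvd k}"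
      then have "\<Prod>A dvd k" by (subst *) auto
      then show "prod f A = (if \<Prod>A dvd k then prod f A else 0)" by simp
    qed (use assms(1) in auto)
    finally show ?thesis .
  qed
  then have "(\<Sum>k=1..M. \<Prod>p\<in>{p\<in>P. p dvd k}. 1 + f p) =
      (\<Sum>A\<in>Pow P. \<Sum>k=1..M. if \<Prod>A dvd k then \<Prod>p\<in>A. f p else 0)"
    by (simp only: sum.swap[of _ "Pow P"])
  also have "\<dots> = (\<Sum>A\<in>Pow P. (\<Prod>p\<in>A. f p) * real (M div \<Prod>A))"
  proof (rule sum.cong)
    fix A assume "A \<in> Pow P"
    then have "\<Prod>A > 0" using assms(2) by (intro prod_pos) (auto simp: prime_gt_0_nat)
    have "(\<Sum>k=1..M. if \<Prod>A dvd k then \<Prod>p\<in>A. f p else 0) = (\<Sum>k\<in>{k\<in>{1..M}. \<Prod>A dvd k}. \<Prod>p\<in>A. f p)"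
      by (rule sum.inter_filter [symmetric]) simp
    also have "\<dots> = real (M div \<Prod>A) * (\<Prod>p\<in>A. f p)"
      unfolding sum_constant card_multiples[OF \<open>\<Prod>A > 0\<close>] ..
    finally show "(\<Sum>k=1..M. if \<Prod>A dvd k then \<Prod>p\<in>A. f p else 0) = (\<Prod>p\<in>A. f p) * real (M div \<Prod>A)"
      by (simp add: mult.commute)
  qed simp
  finally show ?thesis .
qed

text \<open>\<open>M div d\<close> lies between \<open>M / d - 1\<close> and \<open>M / d\<close>.
  As \<open>f \<ge> 0\<close>, rounding costs nothing in the upper bound, so \<open>P\<close> may
  grow with \<open>M\<close> there; in the lower bound it costs the sum of all coefficients, which
  is harmless for a fixed \<open>P\<close>.\<close>

lemma sum_prod_primes_dvd_bounds:
  fixes f :: "nat \<Rightarrow> real"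
  assumes P: "finite P" "\<And>p. p \<in> P \<Longrightarrow> prime p" and f: "\<And>p. p \<in> P \<Longrightarrow> 0 \<le> f p"
  shows "(\<Sum>k=1..M. \<Prod>p\<in>{p\<in>P. p dvd k}. 1 + f p) \<le> real M * (\<Prod>p\<in>P. 1 + f p / real p)"
    and "real M * (\<Prod>p\<in>P. 1 + f p / real p) - (\<Prod>p\<in>P. 1 + f p)
           \<le> (\<Sum>k=1..M. \<Prod>p\<in>{p\<in>P. p dvd k}. 1 + f p)"
proof -
  have exp: "real M * (\<Prod>p\<in>P. 1 + f p / real p) = (\<Sum>A\<in>Pow P. (\<Prod>p\<in>A. f p) * (real M / real (\<Prod>A)))"
    by (simp add: prod_one_plus_eq_sum_Pow[OF P(1)] sum_distrib_left prod_dividef mult.commute)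
  have S: "(\<Sum>k=1..M. \<Prod>p\<in>{p\<in>P. p dvd k}. 1 + f p) = (\<Sum>A\<in>Pow P. (\<Prod>p\<in>A. f p) * real (M div \<Prod>A))"
    using P by (rule sum_prod_primes_dvd)
  have nn: "0 \<le> (\<Prod>p\<in>A. f p)" if "A \<in> Pow P" for A
    using that f by (intro prod_nonneg) auto
  show "(\<Sum>k=1..M. \<Prod>p\<in>{p\<in>P. p dvd k}. 1 + f p) \<le> real M * (\<Prod>p\<in>P. 1 + f p / real p)"
    unfolding S exp
    by (intro sum_mono mult_left_mono nn of_nat_div_le_of_nat)
  have "real M / real d - 1 \<le> real (M div d)" for d
    using real_of_int_div3[of "int M" "int d"] by (simp flip: zdiv_int)
  then have "(\<Sum>A\<in>Pow P. (\<Prod>p\<in>A. f p) * (real M / real (\<Prod>A) - 1))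
      \<le> (\<Sum>A\<in>Pow P. (\<Prod>p\<in>A. f p) * real (M div \<Prod>A))"
    by (intro sum_mono mult_left_mono nn)
  then show "real M * (\<Prod>p\<in>P. 1 + f p / real p) - (\<Prod>p\<in>P. 1 + f p)
           \<le> (\<Sum>k=1..M. \<Prod>p\<in>{p\<in>P. p dvd k}. 1 + f p)"
    unfolding S exp prod_one_plus_eq_sum_Pow[OF P(1), of f]
    by (simp add: sum_subtractf right_diff_distrib)
qed

section \<open>The twin prime product and its truncations\<close>

definition twin_factor :: "nat \<Rightarrow> real" where
  "twin_factor p = (if prime p \<and> p > 2 then 1 - 1 / (real p - 1)\<^sup>2 else 1)"

lemma twin_factor_bounds: "0 < twin_factor p" "twin_factor p \<le> 1"
proof -
  have "1 / (real p - 1)\<^sup>2 < 1" if "p > 2"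
    using that power_strict_mono[of 1 "real p - 1" 2] by (simp add: divide_simps)
  then show "0 < twin_factor p" "twin_factor p \<le> 1" by (auto simp: twin_factor_def)
qed

text \<open>Comparison with inverse squares gives convergence. No factor vanishes, so neither does
  the product, and a nonzero limit of positive partial products is positive.\<close>

lemma twin_factor_LIMSEQ: "(\<lambda>n. \<Prod>p<n. twin_factor p) \<longlonglongrightarrow> twin_prime_const"
  and twin_prime_const_pos: "0 < twin_prime_const"
proof -
  have eq: "twin_prime_const = prodinf twin_factor"
    unfolding twin_prime_const_def twin_factor_def ..
  have "summable (\<lambda>n. 1 / (real (n + 1))\<^sup>2)"
    using inverse_squares_sums[THEN sums_summable] by simp
  \<comment> \<open>The shift by 2 turns \<open>p - 1\<close> into \<open>n + 1\<close>.\<close>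
  then have "summable (\<lambda>n. norm (twin_factor (n + 2) - 1))"
    by (rule summable_comparison_test[rotated]) (auto simp: twin_factor_def add.commute)
  then have "summable (\<lambda>n. norm (twin_factor n - 1))"
    by (subst (asm) summable_iff_shift)
  then have conv: "convergent_prod twin_factor"
    by (intro abs_convergent_prod_imp_convergent_prod summable_imp_abs_convergent_prod)
  have "twin_factor p \<noteq> 0" for p using twin_factor_bounds(1)[of p] by simp
  then have "twin_prime_const \<noteq> 0" unfolding eq using conv by (simp add: prodinf_nonzero)
  have "(\<lambda>n. \<Prod>p\<le>n. twin_factor p) \<longlonglongrightarrow> prodinf twin_factor"
    using conv by (rule convergent_prod_LIMSEQ)
  then show lim: "(\<lambda>n. \<Prod>p<n. twin_factor p) \<longlonglongrightarrow> twin_prime_const"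
    unfolding eq lessThan_Suc_atMost [symmetric] by (subst (asm) filterlim_sequentially_Suc)
  have "0 \<le> twin_prime_const"
    by (rule LIMSEQ_le_const[OF lim]) (intro exI allI impI prod_nonneg less_imp_le twin_factor_bounds)
  with \<open>twin_prime_const \<noteq> 0\<close> show "0 < twin_prime_const" by simp
qed

text \<open>All factors are at most 1, so a long initial product is at most its part over
  \<open>E\<close>.\<close>

lemma twin_prime_const_le:
  assumes "finite E"
  shows "twin_prime_const \<le> (\<Prod>p\<in>E. twin_factor p)"
proof (rule LIMSEQ_le_const2[OF twin_factor_LIMSEQ], intro exI allI impI)
  fix n assume n: "Suc (Max (insert 0 E)) \<le> n"
  have "E \<subseteq> {..<n}"
    using n assms by (auto simp: Suc_le_eq)
  then have "(\<Prod>p<n. twin_factor p) = (\<Prod>p\<in>{..<n} - E. twin_factor p) * (\<Prod>p\<in>E. twin_factor p)"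
    by (intro prod.subset_diff) auto
  also have "\<dots> \<le> 1 * (\<Prod>p\<in>E. twin_factor p)"
    by (intro mult_right_mono prod_le_1 prod_nonneg) (auto intro: less_imp_le twin_factor_bounds)
  finally show "(\<Prod>p<n. twin_factor p) \<le> (\<Prod>p\<in>E. twin_factor p)" by simp
qed

text \<open>The cut-off \<open>z\<close> depends on \<open>\<epsilon>\<close> alone; this is what
  makes the lower bound for the singular series uniform in the modulus.\<close>

lemma twin_prime_const_ge:
  assumes "0 < \<epsilon>"
  obtains z where "(1 - \<epsilon>) * (\<Prod>p<z. twin_factor p) \<le> twin_prime_const"
proof -
  have "(\<lambda>n. (1 - \<epsilon>) * (\<Prod>p<n. twin_factor p)) \<longlonglongrightarrow> (1 - \<epsilon>) * twin_prime_const"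
    by (intro tendsto_intros twin_factor_LIMSEQ)
  moreover have "(1 - \<epsilon>) * twin_prime_const < twin_prime_const"
    using assms twin_prime_const_pos by simp
  ultimately have "\<forall>\<^sub>F n in sequentially. (1 - \<epsilon>) * (\<Prod>p<n. twin_factor p) < twin_prime_const"
    by (rule order_tendstoD)
  then obtain z where "(1 - \<epsilon>) * (\<Prod>p<z. twin_factor p) < twin_prime_const"
    using eventually_happens'[OF sequentially_bot] by blast
  with that show thesis by (meson less_imp_le)
qed

lemma prime_factors_even:
  fixes Q :: nat
  assumes "even Q" "Q > 0"
  shows "prime_factors Q = insert 2 {p. prime p \<and> p dvd Q \<and> p > 2}"
proof -
  have "p = 2 \<or> p > 2" if "prime p" for p :: nat
    using prime_ge_2_nat[OF that] by linarith
  with assms show ?thesis by (auto simp: in_prime_factors_iff)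
qed

text \<open>The prime 2 contributes the factor 2 in front, matching the 2 in the singular
  series.\<close>

lemma divide_totient_even:
  assumes "even Q" "Q > 0"
  shows "real Q / real (totient Q) = 2 * (\<Prod>p\<in>{p. prime p \<and> p dvd Q \<and> p > 2}. real p / (real p - 1))"
proof -
  have fin: "finite {p. prime p \<and> p dvd Q \<and> p > 2}"
    by (rule finite_subset[of _ "{..Q}"]) (use assms in \<open>auto simp: dvd_imp_le\<close>)
  have "real Q / real (totient Q) = (\<Prod>p\<in>prime_factors Q. inverse (1 - 1 / real p))"
    using assms prod_inversef[of "\<lambda>p. 1 - 1 / real p" "prime_factors Q"]
    by (simp add: totient_formula2 divide_inverse [of "real Q"] o_def)
  also have "\<dots> = 2 * (\<Prod>p\<in>{p. prime p \<and> p dvd Q \<and> p > 2}. inverse (1 - 1 / real p))"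
    using fin by (simp add: prime_factors_even[OF assms])
  also have "(\<Prod>p\<in>{p. prime p \<and> p dvd Q \<and> p > 2}. inverse (1 - 1 / real p)) =
      (\<Prod>p\<in>{p. prime p \<and> p dvd Q \<and> p > 2}. real p / (real p - 1))"
    by (intro prod.cong) (auto simp: field_simps)
  finally show ?thesis .
qed

text \<open>
  With \<open>f(p) = 1 / (p - 2)\<close>, the product over \<open>p | Qk\<close> splits into a part depending only on \<open>Q\<close> and
  a product of \<open>1 + f(p)\<close> over the primes dividing \<open>k\<close> but not \<open>Q\<close>; expanding the latter over sets of primes gives
  its mean value. Truncating at primes below a fixed \<open>z\<close> gives a lower bound with an error
  that does not depend on \<open>Q\<close>.
\<close>

locale even_modulus =
  fixes Q :: nat
  assumes even_Q: "even Q" and Q_pos: "Q > 0"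
begin

definition modulus_primes :: "nat set" where "modulus_primes = {p. prime p \<and> p dvd Q \<and> p > 2}"

definition other_primes :: "nat \<Rightarrow> nat set" where "other_primes z = {p. prime p \<and> p > 2 \<and> p < z \<and> \<not> p dvd Q}"

text \<open>This equals \<open>singular_series Q\<close>, as
  \<open>(p - 1) / (p - 2) = 1 + 1 / (p - 2)\<close>.\<close>

definition modulus_factor :: real where "modulus_factor = 2 * twin_prime_const * (\<Prod>p\<in>modulus_primes. 1 + 1 / (real p - 2))"

lemma finite_modulus_primes: "finite modulus_primes"
  unfolding modulus_primes_def by (rule finite_subset[of _ "{..Q}"]) (use Q_pos in \<open>auto simp: dvd_imp_le\<close>)

lemma finite_other_primes: "finite (other_primes z)"
  unfolding other_primes_def by (rule finite_subset[of _ "{..<z}"]) auto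

lemma modulus_factor_nonneg: "0 \<le> modulus_factor"
  unfolding modulus_factor_def modulus_primes_def using twin_prime_const_pos by (intro mult_nonneg_nonneg prod_nonneg) auto

text \<open>The odd primes dividing \<open>Q * k\<close> are those of \<open>Q\<close> and those of
  \<open>k\<close> that miss \<open>Q\<close>. Cutting the latter off at \<open>z\<close> drops only
  factors \<open>\<ge> 1\<close>, and drops none when \<open>k < z\<close>.\<close>

lemma singular_series_mult:
  assumes "k > 0"
  shows "modulus_factor * (\<Prod>p\<in>{p\<in>other_primes z. p dvd k}. 1 + 1 / (real p - 2)) \<le> singular_series (Q * k)"
    and "k < z \<Longrightarrow>
      singular_series (Q * k) = modulus_factor * (\<Prod>p\<in>{p\<in>other_primes z. p dvd k}. 1 + 1 / (real p - 2))"
proof -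
  let ?E = "{p. prime p \<and> p dvd Q * k \<and> p > 2}"
  have fin: "finite ?E"
    by (rule finite_subset[of _ "{..Q * k}"]) (use Q_pos assms in \<open>auto simp: dvd_imp_le\<close>)
  have ss: "singular_series (Q * k) = 2 * twin_prime_const * (\<Prod>p\<in>?E. 1 + 1 / (real p - 2))"
    using even_Q Q_pos assms by (auto simp: singular_series_def field_simps intro!: prod.cong)
  have main: "modulus_factor * (\<Prod>p\<in>{p\<in>other_primes z. p dvd k}. 1 + 1 / (real p - 2)) =
      2 * twin_prime_const * (\<Prod>p\<in>modulus_primes \<union> {p\<in>other_primes z. p dvd k}. 1 + 1 / (real p - 2))"
    unfolding modulus_factor_def using finite_modulus_primes finite_other_primes
    by (subst prod.union_disjoint) (auto simp: modulus_primes_def other_primes_def)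
  show "modulus_factor * (\<Prod>p\<in>{p\<in>other_primes z. p dvd k}. 1 + 1 / (real p - 2)) \<le> singular_series (Q * k)"
    unfolding ss main using twin_prime_const_pos fin
    by (intro mult_left_mono prod_mono2) (auto simp: modulus_primes_def other_primes_def)
  assume "k < z"
  then have "modulus_primes \<union> {p\<in>other_primes z. p dvd k} = ?E"
    using assms by (auto simp: modulus_primes_def other_primes_def prime_dvd_mult_iff intro: le_less_trans[OF dvd_imp_le])
  then show "singular_series (Q * k) = modulus_factor * (\<Prod>p\<in>{p\<in>other_primes z. p dvd k}. 1 + 1 / (real p - 2))"
    unfolding ss main by simp
qed

text \<open>The factors cancel prime by prime: at a prime of \<open>Q\<close> they combine to
  \<open>p / (p - 1)\<close>, and at another prime the mean value factor
  \<open>(p - 1)^2 / (p * (p - 2))\<close> is the inverse of \<open>twin_factor p\<close>.\<close>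

lemma euler_factor_identity:
  "2 * (\<Prod>p\<in>modulus_primes \<union> other_primes z. twin_factor p) * (\<Prod>p\<in>modulus_primes. 1 + 1 / (real p - 2))
     * (\<Prod>p\<in>other_primes z. 1 + 1 / (real p - 2) / real p) = real Q / real (totient Q)"
proof -
  have RP: "(\<Prod>p\<in>modulus_primes \<union> other_primes z. twin_factor p) = (\<Prod>p\<in>modulus_primes. twin_factor p) * (\<Prod>p\<in>other_primes z. twin_factor p)"
    using finite_modulus_primes finite_other_primes by (intro prod.union_disjoint) (auto simp: modulus_primes_def other_primes_def)
  have 1: "twin_factor p * (1 + 1 / (real p - 2)) = real p / (real p - 1)"
    if "prime p" "p > 2" for p
  proof -
    have "real p - 1 > 0" "real p - 2 > 0" using that by auto
    then show ?thesis using that unfolding twin_factor_def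
      by (simp add: divide_simps) (simp add: power2_eq_square algebra_simps)
  qed
  have 2: "twin_factor p * (1 + 1 / (real p - 2) / real p) = 1"
    if "prime p" "p > 2" for p
  proof -
    have "real p - 1 > 0" "real p - 2 > 0" "real p > 0" using that by auto
    then show ?thesis using that unfolding twin_factor_def
      by (simp add: divide_simps) (simp add: power2_eq_square algebra_simps)
  qed
  have "(\<Prod>p\<in>modulus_primes. twin_factor p) * (\<Prod>p\<in>modulus_primes. 1 + 1 / (real p - 2)) = (\<Prod>p\<in>modulus_primes. real p / (real p - 1))"
    unfolding prod.distrib [symmetric] by (intro prod.cong 1) (auto simp: modulus_primes_def)
  moreover have "(\<Prod>p\<in>other_primes z. twin_factor p) * (\<Prod>p\<in>other_primes z. 1 + 1 / (real p - 2) / real p) = 1"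
    unfolding prod.distrib [symmetric] by (intro prod.neutral ballI 2) (auto simp: other_primes_def)
  ultimately show ?thesis
    unfolding divide_totient_even[OF even_Q Q_pos] RP modulus_primes_def [symmetric]
    by (metis (no_types, lifting) mult.assoc mult.left_commute mult.right_neutral)
qed

lemma main_factor_le: "modulus_factor * (\<Prod>p\<in>other_primes z. 1 + 1 / (real p - 2) / real p) \<le> real Q / real (totient Q)"
proof -
  have "twin_prime_const \<le> (\<Prod>p\<in>modulus_primes \<union> other_primes z. twin_factor p)"
    using finite_modulus_primes finite_other_primes by (intro twin_prime_const_le) auto
  then show ?thesis unfolding modulus_factor_def euler_factor_identity [of z, symmetric]
    by (intro mult_right_mono mult_left_mono prod_nonneg) (auto simp: modulus_primes_def other_primes_def)
qed

text \<open>Every odd prime below \<open>z\<close> lies in \<open>modulus_primes\<close> or in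
  \<open>other_primes z\<close>, and any further factors are at most 1. So the one choice of
  \<open>z\<close> serves every \<open>Q\<close>.\<close>

lemma main_factor_ge:
  assumes "\<epsilon> \<le> 1" "(1 - \<epsilon>) * (\<Prod>p<z. twin_factor p) \<le> twin_prime_const"
  shows "(1 - \<epsilon>) * (real Q / real (totient Q)) \<le> modulus_factor * (\<Prod>p\<in>other_primes z. 1 + 1 / (real p - 2) / real p)"
proof -
  have "(\<Prod>p\<in>modulus_primes \<union> other_primes z. twin_factor p) = (\<Prod>p\<in>(modulus_primes \<union> other_primes z) \<union> {..<z}. twin_factor p)"
    using finite_modulus_primes finite_other_primes
    by (intro prod.mono_neutral_left) (auto simp: modulus_primes_def other_primes_def twin_factor_def)
  also have "\<dots> = (\<Prod>p\<in>((modulus_primes \<union> other_primes z) \<union> {..<z}) - {..<z}. twin_factor p) * (\<Prod>p<z. twin_factor p)"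
    using finite_modulus_primes finite_other_primes by (intro prod.subset_diff) auto
  also have "\<dots> \<le> 1 * (\<Prod>p<z. twin_factor p)"
    by (intro mult_right_mono prod_le_1 prod_nonneg) (auto intro: less_imp_le twin_factor_bounds)
  finally have "(1 - \<epsilon>) * (\<Prod>p\<in>modulus_primes \<union> other_primes z. twin_factor p) \<le> twin_prime_const"
    using mult_left_mono[of _ _ "1 - \<epsilon>"] assms by fastforce
  then have "(2 * ((1 - \<epsilon>) * (\<Prod>p\<in>modulus_primes \<union> other_primes z. twin_factor p))) * (\<Prod>p\<in>modulus_primes. 1 + 1 / (real p - 2))
     * (\<Prod>p\<in>other_primes z. 1 + 1 / (real p - 2) / real p) \<le> modulus_factor * (\<Prod>p\<in>other_primes z. 1 + 1 / (real p - 2) / real p)"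
    unfolding modulus_factor_def
    by (intro mult_right_mono mult_left_mono prod_nonneg) (auto simp: modulus_primes_def other_primes_def)
  then show ?thesis unfolding euler_factor_identity [of z, symmetric] by (simp add: mult_ac)
qed

text \<open>The cut-off \<open>z = M + 1\<close> loses no prime factor of any
  \<open>k \<le> M\<close>, and the upper bound for the mean carries no error that could grow with
  it.\<close>

lemma sum_singular_series_le:
  "(\<Sum>k=1..M. singular_series (Q * k)) \<le> real M * (real Q / real (totient Q))"
proof -
  have "(\<Sum>k=1..M. singular_series (Q * k)) =
      modulus_factor * (\<Sum>k=1..M. \<Prod>p\<in>{p\<in>other_primes (Suc M). p dvd k}. 1 + 1 / (real p - 2))"
    unfolding sum_distrib_left by (intro sum.cong singular_series_mult) auto
  also have "\<dots> \<le> modulus_factor * (real M * (\<Prod>p\<in>other_primes (Suc M). 1 + 1 / (real p - 2) / real p))"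
    by (intro mult_left_mono modulus_factor_nonneg sum_prod_primes_dvd_bounds finite_other_primes) (auto simp: other_primes_def)
  also have "\<dots> = real M * (modulus_factor * (\<Prod>p\<in>other_primes (Suc M). 1 + 1 / (real p - 2) / real p))" by simp
  also have "\<dots> \<le> real M * (real Q / real (totient Q))"
    by (intro mult_left_mono main_factor_le) auto
  finally show ?thesis .
qed

text \<open>Here \<open>z\<close> is fixed: the rounding error is bounded by the product
  \<open>?C\<close> over all odd primes below \<open>z\<close>, which involves neither
  \<open>Q\<close> nor \<open>M\<close>.\<close>

lemma sum_singular_series_ge:
  assumes "\<epsilon> \<le> 1" "(1 - \<epsilon>) * (\<Prod>p<z. twin_factor p) \<le> twin_prime_const"
  shows "((1 - \<epsilon>) * real M - (\<Prod>p\<in>{p. prime p \<and> 2 < p \<and> p < z}. 1 + 1 / (real p - 2)))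
      * (real Q / real (totient Q)) \<le> (\<Sum>k=1..M. singular_series (Q * k))"
    (is "(_ - ?C) * ?r \<le> _")
proof -
  have C: "(\<Prod>p\<in>other_primes z. 1 + 1 / (real p - 2)) \<le> ?C"
    by (rule prod_mono2) (auto simp: other_primes_def)
  \<comment> \<open>With cut-off 0 the product is empty and a bound for
    \<open>modulus_factor\<close> alone is left.\<close>
  have "modulus_factor * (\<Prod>p\<in>other_primes 0. 1 + 1 / (real p - 2) / real p) \<le> ?r" by (rule main_factor_le)
  then have Ar: "modulus_factor \<le> ?r" by (simp add: other_primes_def)
  have "((1 - \<epsilon>) * real M - ?C) * ?r = real M * ((1 - \<epsilon>) * ?r) - ?r * ?C"
    by (simp only: left_diff_distrib right_diff_distrib mult_ac)
  also have "\<dots> \<le> real M * (modulus_factor * (\<Prod>p\<in>other_primes z. 1 + 1 / (real p - 2) / real p))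
      - modulus_factor * (\<Prod>p\<in>other_primes z. 1 + 1 / (real p - 2))"
    by (intro diff_mono mult_left_mono main_factor_ge assms mult_mono Ar C prod_nonneg)
       (auto simp: other_primes_def)
  also have "\<dots> = modulus_factor * (real M * (\<Prod>p\<in>other_primes z. 1 + 1 / (real p - 2) / real p)
      - (\<Prod>p\<in>other_primes z. 1 + 1 / (real p - 2)))" by (simp add: algebra_simps)
  also have "\<dots> \<le> modulus_factor * (\<Sum>k=1..M. \<Prod>p\<in>{p\<in>other_primes z. p dvd k}. 1 + 1 / (real p - 2))"
    by (intro mult_left_mono modulus_factor_nonneg sum_prod_primes_dvd_bounds finite_other_primes) (auto simp: other_primes_def)
  also have "\<dots> \<le> (\<Sum>k=1..M. singular_series (Q * k))"
    unfolding sum_distrib_left by (intro sum_mono singular_series_mult) auto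
  finally show ?thesis .
qed

end

text \<open>The singular series vanishes at odd \<open>n\<close>, so only multiples of
  \<open>Q = lcm 2 q\<close> count. Each contributes \<open>Q / totient Q\<close> on average, which
  is a density of \<open>1 / totient q\<close> for either parity of \<open>q\<close>. Partial
  summation adds the weight \<open>n\<close>.\<close>

lemma sum_singular_series_multiples:
  assumes "0 < \<epsilon>" "\<epsilon> \<le> 1"
  shows "\<exists>C. \<forall>q>0. \<forall>N.
    \<bar>(\<Sum>n\<le>N. (if q dvd n then singular_series n else 0) * real n) - (real N)\<^sup>2 / (2 * real (totient q))\<bar>
      \<le> real N / real (totient q) * (1 / 2 + 2 * (\<epsilon> * real N + C * real q))"
proof -
  obtain z where z: "(1 - \<epsilon>) * (\<Prod>p<z. twin_factor p) \<le> twin_prime_const"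
    using twin_prime_const_ge[OF assms(1)] .
  define C0 where "C0 = (\<Prod>p\<in>{p. prime p \<and> 2 < p \<and> p < z}. 1 + 1 / (real p - 2))"
  have C0: "C0 \<ge> 0" unfolding C0_def by (intro prod_nonneg) auto
  show ?thesis
  \<comment> \<open>One \<open>Q\<close> is lost by rounding \<open>u\<close> down to a multiple of
    \<open>Q\<close>, \<open>C0 * Q\<close> by the cut-off, and
    \<open>Q \<le> 2 * q\<close>.\<close>
  proof (intro exI[of _ "2 * (1 + C0)"] allI impI)
    fix q N :: nat assume q: "q > 0"
    define s where "s n = (if q dvd n then singular_series n else 0)" for n
    define Q where "Q = lcm 2 q"
    define \<phi> where "\<phi> = real (totient q)"
    have \<phi>: "\<phi> > 0" using q by (simp add: \<phi>_def)
    have Q: "Q > 0" "even Q" using q by (auto simp: Q_def lcm_pos_nat)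
    interpret even_modulus Q by unfold_locales (fact Q)+
    have Q2: "Q = (if even q then q else 2 * q)"
    proof (cases "even q")
      case False
      then have "coprime 2 q" by simp
      then have "lcm 2 q = 2 * q" using lcm_coprime[of 2 q] by simp
      with False show ?thesis by (simp add: Q_def)
    qed (simp add: Q_def lcm_proj2_if_dvd)
    \<comment> \<open>Doubling an odd number does not change its totient.\<close>
    have tot: "real (totient Q) = \<phi>" by (auto simp: Q2 \<phi>_def totient_double)
    have "Q \<le> 2 * q" by (auto simp: Q2)
    then have Qq: "real Q \<le> 2 * real q" by linarith
    have part: "(\<Sum>n\<le>u. s n) = (\<Sum>k=1..u div Q. singular_series (Q * k))" for u
    proof -
      have "(\<Sum>n\<le>u. s n) = (\<Sum>n\<in>(\<lambda>k. Q * k) ` {1..u div Q}. s n)"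
      proof (rule sum.mono_neutral_right)
        show "\<forall>n\<in>{..u} - (\<lambda>k. Q * k) ` {1..u div Q}. s n = 0"
        proof (rule ballI, rule ccontr)
          fix n assume n: "n \<in> {..u} - (\<lambda>k. Q * k) ` {1..u div Q}" "s n \<noteq> 0"
          then have "q dvd n" "even n" "n > 0"
            by (auto simp: s_def singular_series_def split: if_splits)
          then have "Q dvd n" by (simp add: Q_def)
          then obtain k where k: "n = Q * k" by blast
          with n \<open>n > 0\<close> Q(1) have "1 \<le> k" "k \<le> u div Q"
            by (auto simp: less_eq_div_iff_mult_less_eq mult.commute)
          with k n show False by auto
        qed
      qed (auto simp: less_eq_div_iff_mult_less_eq Q(1) mult.commute)
      also have "\<dots> = (\<Sum>k=1..u div Q. s (Q * k))"
        using Q(1) by (subst sum.reindex) (auto simp: inj_on_def)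
      also have "\<dots> = (\<Sum>k=1..u div Q. singular_series (Q * k))"
        by (intro sum.cong) (auto simp: s_def Q_def)
      finally show ?thesis .
    qed
    have approx: "\<bar>(\<Sum>n\<le>u. s n) - 1 / \<phi> * real u\<bar> \<le> (\<epsilon> * real N + 2 * (1 + C0) * real q) / \<phi>"
      if "u \<le> N" for u
    proof -
      define M where "M = u div Q"
      have M1: "real M * real Q \<le> real u"
        unfolding M_def by (metis div_times_less_eq_dividend of_nat_le_iff of_nat_mult)
      have "u < (M + 1) * Q"
        unfolding M_def using Q(1) dividend_less_div_times[of Q u] by simp
      then have "real u < real ((M + 1) * Q)" by (rule of_nat_less_iff[THEN iffD2])
      then have M2: "real u - real Q \<le> real M * real Q" by (simp add: algebra_simps)
      have "(\<Sum>n\<le>u. s n) \<le> real M * (real Q / \<phi>)"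
        unfolding part M_def tot [symmetric] by (rule sum_singular_series_le)
      also have "\<dots> \<le> 1 / \<phi> * real u"
        using M1 \<phi> by (simp add: divide_right_mono)
      finally have up: "(\<Sum>n\<le>u. s n) \<le> 1 / \<phi> * real u" .
      have "(1 - \<epsilon>) * (real u - real Q) \<le> (1 - \<epsilon>) * (real M * real Q)"
        using M2 assms by (intro mult_left_mono) auto
      moreover have "\<epsilon> * real u \<le> \<epsilon> * real N" "0 \<le> \<epsilon> * real Q"
        using that assms by (auto intro!: mult_left_mono)
      moreover have "(1 + C0) * real Q \<le> (1 + C0) * (2 * real q)"
        using Qq C0 by (intro mult_left_mono) auto
      ultimately have "real u - (\<epsilon> * real N + 2 * (1 + C0) * real q) \<le> ((1 - \<epsilon>) * real M - C0) * real Q"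
        by (simp add: algebra_simps)
      then have "(real u - (\<epsilon> * real N + 2 * (1 + C0) * real q)) / \<phi> \<le> ((1 - \<epsilon>) * real M - C0) * real Q / \<phi>"
        using \<phi> by (intro divide_right_mono) auto
      also have "\<dots> \<le> (\<Sum>n\<le>u. s n)"
        using sum_singular_series_ge[OF assms(2) z, of M]
        unfolding part M_def tot C0_def by simp
      finally have "1 / \<phi> * real u - (\<epsilon> * real N + 2 * (1 + C0) * real q) / \<phi> \<le> (\<Sum>n\<le>u. s n)"
        by (simp add: diff_divide_distrib)
      moreover have "0 \<le> (\<epsilon> * real N + 2 * (1 + C0) * real q) / \<phi>"
        using assms C0 \<phi> by (intro divide_nonneg_pos add_nonneg_nonneg mult_nonneg_nonneg) auto
      ultimately show ?thesis using up by linarith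
    qed
    have "\<bar>(\<Sum>n\<le>N. s n * real n) - 1 / \<phi> * (real N)\<^sup>2 / 2\<bar>
      \<le> \<bar>1 / \<phi>\<bar> * real N / 2 + 2 * real N * ((\<epsilon> * real N + 2 * (1 + C0) * real q) / \<phi>)"
      by (rule sum_weighted_approx) (rule approx)
    also have "\<dots> = real N / \<phi> * (1 / 2 + 2 * (\<epsilon> * real N + 2 * (1 + C0) * real q))"
      using \<phi> by (simp add: field_simps)
    finally show "\<bar>(\<Sum>n\<le>N. (if q dvd n then singular_series n else 0) * real n)
        - (real N)\<^sup>2 / (2 * real (totient q))\<bar>
      \<le> real N / real (totient q) * (1 / 2 + 2 * (\<epsilon> * real N + 2 * (1 + C0) * real q))"
      unfolding s_def \<phi>_def by simp
  qed
qed

section \<open>Real characters\<close>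

lemma minus_in_totatives:
  fixes q :: nat
  assumes "q > 1" "a \<in> totatives q"
  shows "q - a \<in> totatives q"
proof -
  have "a < q" by (rule totatives_less[OF assms(2,1)])
  then have "coprime (q - a) q \<longleftrightarrow> coprime a q"
    unfolding coprime_iff_gcd_eq_1 by (subst gcd_diff2_nat) auto
  then show ?thesis using assms \<open>a < q\<close> by (auto simp: totatives_def)
qed

context
  fixes q :: nat and X :: "nat \<Rightarrow> complex" and \<xi> :: "nat \<Rightarrow> real"
  assumes X: "real_dirichlet_character q X"
  defines "\<xi> \<equiv> (\<lambda>n. Re (X n))"
begin

lemma real_character_modulus_pos: "q > 0"
  using X by (simp add: real_dirichlet_character_def dirichlet_character_def)

lemma real_character_of_real: "X n = of_real (\<xi> n)"
proof -
  have "X n \<in> \<real>" using X by (auto simp: real_dirichlet_character_def)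
  then show ?thesis by (simp add: \<xi>_def of_real_Re)
qed

lemma real_character_mult: "\<xi> (m * n) = \<xi> m * \<xi> n"
proof -
  have "X (m * n) = X m * X n"
    using X by (simp add: real_dirichlet_character_def dirichlet_character_def)
  then show ?thesis using real_character_of_real by (metis of_real_eq_iff of_real_mult)
qed

lemma real_character_add_mult: "\<xi> (n + k * q) = \<xi> n"
proof (induction k)
  case (Suc k)
  have "X (n + k * q + q) = X (n + k * q)"
    using X by (simp add: real_dirichlet_character_def dirichlet_character_def)
  with Suc show ?case by (simp add: \<xi>_def algebra_simps)
qed simp

lemma real_character_mod: "\<xi> (n mod q) = \<xi> n"
  using real_character_add_mult[of "n mod q" "n div q"] by simp

lemma real_character_nonzero: "coprime n q \<Longrightarrow> \<xi> n \<noteq> 0"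
  using X real_character_of_real[of n]
  by (auto simp: real_dirichlet_character_def dirichlet_character_def)

lemma real_character_one: "\<xi> 1 = 1"
  using real_character_mult[of 1 1] real_character_nonzero[of 1] by simp

lemma real_character_power: "\<xi> (n ^ k) = \<xi> n ^ k"
  by (induction k) (simp_all add: real_character_mult real_character_one[simplified])

text \<open>By Euler's theorem a power of \<open>\<xi> n\<close> with positive exponent is 1, and
  \<open>\<xi> n\<close> is real.\<close>

lemma real_character_values:
  assumes "coprime n q"
  shows "\<xi> n = 1 \<or> \<xi> n = -1"
proof -
  have "[n ^ totient q = 1] (mod q)" using assms by (rule euler_theorem)
  then have "\<xi> (n ^ totient q) = \<xi> 1"
    by (metis cong_def real_character_mod)
  then have "\<bar>\<xi> n\<bar> ^ totient q = 1 ^ totient q"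
    by (simp add: real_character_power real_character_one[simplified] flip: power_abs)
  then have "\<bar>\<xi> n\<bar> = 1"
    using real_character_modulus_pos by (subst (asm) power_eq_iff_eq_base) auto
  then show ?thesis by linarith
qed

text \<open>\<open>q - a\<close> represents the class of \<open>-a\<close>, and \<open>q - 1\<close>
  that of \<open>-1\<close>.\<close>

lemma real_character_uminus:
  assumes "a \<in> totatives q"
  shows "\<xi> (q - a) = \<xi> (q - 1) * \<xi> a"
proof -
  have "a \<ge> 1" "a \<le> q" using assms by (auto simp: totatives_def)
  then have "(q - 1) * a = (q - a) + (a - 1) * q"
    by (simp add: algebra_simps diff_mult_distrib)
  then show ?thesis using real_character_mult real_character_add_mult by metis
qed

text \<open>If some \<open>b\<close> has value -1, multiplication by \<open>b\<close> permutes the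
  reduced residues and changes the sign of the sum.\<close>

lemma sum_real_character:
  assumes "q > 1"
  shows "(\<forall>a\<in>totatives q. \<xi> a = 1) \<or> (\<Sum>a\<in>totatives q. \<xi> a) = 0"
proof (rule disjCI)
  assume "(\<Sum>a\<in>totatives q. \<xi> a) \<noteq> 0"
  show "\<forall>a\<in>totatives q. \<xi> a = 1"
  proof (rule ccontr)
    assume "\<not> (\<forall>a\<in>totatives q. \<xi> a = 1)"
    then obtain b where b: "b \<in> totatives q" "\<xi> b = -1"
      using real_character_values by (auto simp: totatives_def)
    have inj: "inj_on (\<lambda>a. a * b mod q) (totatives q)"
    proof (rule inj_onI)
      fix x y assume xy: "x \<in> totatives q" "y \<in> totatives q" "x * b mod q = y * b mod q"
      then have "[x = y] (mod q)"
        using b(1) by (simp add: totatives_def cong_def [symmetric] cong_mult_rcancel_nat)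
      then show "x = y"
        using xy totatives_less[OF _ assms] by (simp add: cong_def)
    qed
    have sub: "(\<lambda>a. a * b mod q) ` totatives q \<subseteq> totatives q"
    proof safe
      fix a assume a: "a \<in> totatives q"
      with b have c: "coprime (a * b mod q) q" by (simp add: totatives_def)
      then have "a * b mod q \<noteq> 0" using assms by (intro notI) simp
      with c assms show "a * b mod q \<in> totatives q" by (auto simp: totatives_def less_imp_le)
    qed
    have "(\<lambda>a. a * b mod q) ` totatives q = totatives q"
      using inj sub by (intro endo_inj_surj) auto
    then have "(\<Sum>a\<in>totatives q. \<xi> a) = (\<Sum>a\<in>totatives q. \<xi> (a * b mod q))"
      using sum.reindex[OF inj, of \<xi>] by (simp add: o_def)
    also have "\<dots> = - (\<Sum>a\<in>totatives q. \<xi> a)"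
      by (simp add: real_character_mod real_character_mult b(2) sum_negf)
    finally show False using \<open>(\<Sum>a\<in>totatives q. \<xi> a) \<noteq> 0\<close> by simp
  qed
qed

text \<open>\<open>\<rho>\<close> is the mean of the character over the reduced residues and
  \<open>\<sigma>\<close> its value at -1. The three pairs are, in order, the even nonprincipal, the
  odd nonprincipal and the principal case.\<close>

lemma sum_character_pairs:
  assumes "q > 1"
  obtains \<rho> \<sigma> :: real where "(\<rho>, \<sigma>) \<in> {(0, 1), (0, -1), (1, 1)}"
    "\<And>Y. (\<Sum>a\<in>totatives q. (1 - \<xi> a * Y) * (1 - \<xi> (q - a) * Y)) =
       real (totient q) * (1 - 2 * \<rho> * Y + \<sigma> * Y\<^sup>2)"
proof -
  define \<sigma> where "\<sigma> = \<xi> (q - 1)"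
  have m1: "q - 1 \<in> totatives q" using minus_in_totatives[OF assms, of 1] assms by simp
  then have \<sigma>: "\<sigma> = 1 \<or> \<sigma> = -1"
    unfolding \<sigma>_def by (intro real_character_values) (simp add: totatives_def)
  have eq: "(\<Sum>a\<in>totatives q. (1 - \<xi> a * Y) * (1 - \<xi> (q - a) * Y)) =
      real (totient q) * (1 + \<sigma> * Y\<^sup>2) - Y * (1 + \<sigma>) * (\<Sum>a\<in>totatives q. \<xi> a)" for Y
  proof -
    have "(1 - \<xi> a * Y) * (1 - \<xi> (q - a) * Y) = (1 + \<sigma> * Y\<^sup>2) - Y * (1 + \<sigma>) * \<xi> a"
      if a: "a \<in> totatives q" for a
    proof -
      have "\<xi> a = 1 \<or> \<xi> a = -1" using a by (intro real_character_values) (simp add: totatives_def)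
      \<comment> \<open>As \<open>\<xi> a * \<xi> a = 1\<close>, the quadratic term does not depend
        on \<open>a\<close>.\<close>
      then show ?thesis unfolding real_character_uminus[OF a] \<sigma>_def [symmetric]
        by (auto simp: algebra_simps power2_eq_square)
    qed
    then show ?thesis
      by (simp add: sum_subtractf sum_distrib_left totient_def)
  qed
  show thesis
  proof (cases "\<forall>a\<in>totatives q. \<xi> a = 1")
    case True
    then have "\<sigma> = 1" "(\<Sum>a\<in>totatives q. \<xi> a) = real (totient q)"
      using m1 by (auto simp: \<sigma>_def totient_def)
    then show thesis using eq by (intro that[of 1 1]) (auto simp: algebra_simps)
  next
    case False
    then have "(\<Sum>a\<in>totatives q. \<xi> a) = 0" using sum_real_character[OF assms] by blast
    then show thesis using eq \<sigma> by (intro that[of 0 \<sigma>]) auto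
  qed
qed

end

section \<open>The Goldbach sum over multiples\<close>

text \<open>The end terms \<open>m = 0\<close> and \<open>m = n\<close> vanish because
  \<open>mangoldt 0 = 0\<close>.\<close>

lemma psi2_eq: "psi2 n = (\<Sum>m\<le>n. mangoldt m * mangoldt (n - m))"
proof -
  have "psi2 n = (\<Sum>m | 0 < m \<and> m < n. mangoldt m * mangoldt (n - m))"
    unfolding psi2_def
    by (rule sum.reindex_bij_witness[of _ "\<lambda>m. (m, n - m)" fst]) auto
  also have "\<dots> = (\<Sum>m\<le>n. mangoldt m * mangoldt (n - m))"
    by (rule sum.mono_neutral_left) (auto intro!: gr0I le_neq_implies_less)
  finally show ?thesis .
qed

lemma psi2_nonneg: "0 \<le> psi2 n"
  unfolding psi2_eq by (intro sum_nonneg mult_nonneg_nonneg mangoldt_nonneg)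

lemma sum_diagonals:
  fixes g :: "nat \<Rightarrow> nat \<Rightarrow> real"
  shows "(\<Sum>n\<le>N. \<Sum>m\<le>n. g m (n - m)) = (\<Sum>m\<le>N. \<Sum>k\<le>N - m. g m k)"
proof -
  have "(\<Sum>n\<le>N. \<Sum>m\<le>n. g m (n - m)) = (\<Sum>(m, k)\<in>{(m, k). m + k \<le> N}. g m k)"
    by (rule sum.triangle_reindex_eq [symmetric])
  also have "{(m, k). m + k \<le> N} = Sigma {..N} (\<lambda>m. {..N - m})" by auto
  finally show ?thesis by (simp add: sum.Sigma)
qed

text \<open>The conjecture is silent on odd \<open>n\<close>, which occur among the multiples of an
  odd \<open>q\<close>. One of the two summands is then even, hence a power of 2 wherever
  \<open>mangoldt\<close> is nonzero, and these have total weight at most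
  \<open>ln N\<close>.\<close>

lemma sum_psi2_odd_le:
  assumes "N > 0"
  shows "(\<Sum>n\<le>N. if odd n then psi2 n else 0) \<le> 2 * real N * (ln (real N))\<^sup>2"
proof -
  let ?g = "\<lambda>m k. (if even m then mangoldt m else 0 :: real) * mangoldt k"
  have "(if odd n then psi2 n else 0) \<le> 2 * (\<Sum>m\<le>n. ?g m (n - m))" for n
  proof (cases "odd n")
    case True
    have "psi2 n \<le> (\<Sum>m\<le>n. ?g m (n - m) + ?g (n - m) m)"
      unfolding psi2_eq using True by (intro sum_mono) (auto simp: mangoldt_nonneg)
    also have "\<dots> = (\<Sum>m\<le>n. ?g m (n - m)) + (\<Sum>m\<le>n. ?g (n - m) m)"
      by (rule sum.distrib)
    also have "(\<Sum>m\<le>n. ?g (n - m) m) = (\<Sum>m\<le>n. ?g m (n - m))"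
      by (rule sum.reindex_bij_witness[of _ "\<lambda>m. n - m" "\<lambda>m. n - m"]) auto
    finally show ?thesis using True by simp
  qed (auto intro!: sum_nonneg simp: mangoldt_nonneg)
  then have "(\<Sum>n\<le>N. if odd n then psi2 n else 0) \<le> (\<Sum>n\<le>N. 2 * (\<Sum>m\<le>n. ?g m (n - m)))"
    by (intro sum_mono)
  also have "\<dots> = 2 * (\<Sum>m\<le>N. \<Sum>k\<le>N - m. ?g m k)"
    by (simp only: sum_distrib_left [symmetric] sum_diagonals[of ?g])
  also have "\<dots> \<le> 2 * (\<Sum>m\<le>N. \<Sum>k\<le>N. ?g m k)"
    by (intro mult_left_mono sum_mono sum_mono2) (auto simp: mangoldt_nonneg)
  also have "\<dots> = 2 * ((\<Sum>m\<le>N. if even m then mangoldt m else 0) * (\<Sum>k\<le>N. mangoldt k))"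
    by (simp only: sum_product)
  also have "(\<Sum>m\<le>N. if even m then mangoldt m else 0 :: real) = (\<Sum>m | m \<le> N \<and> 2 dvd m. mangoldt m)"
    by (simp add: sum.inter_filter [symmetric])
  also have "2 * (\<dots> * (\<Sum>k\<le>N. mangoldt k)) \<le> 2 * (ln (real N) * (real N * ln (real N)))"
    using assms
    by (intro mult_left_mono mult_mono sum_mangoldt_dvd_le sum_mangoldt_le sum_nonneg)
       (auto simp: mangoldt_nonneg)
  finally show ?thesis by (simp add: power2_eq_square algebra_simps)
qed

definition mangoldt_AP :: "nat \<Rightarrow> nat \<Rightarrow> nat \<Rightarrow> real" where
  "mangoldt_AP q a m = (if [m = a] (mod q) then mangoldt m else 0)"

lemma mangoldt_AP_nonneg: "0 \<le> mangoldt_AP q a m"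
  by (simp add: mangoldt_AP_def mangoldt_nonneg)

lemma psi_AP_eq: "psi_AP (real u) q a = (\<Sum>m\<le>u. mangoldt_AP q a m)"
proof -
  have "psi_AP (real u) q a = (\<Sum>m | 1 \<le> m \<and> m \<le> u \<and> [m = a] (mod q). mangoldt_AP q a m)"
    unfolding psi_AP_def by (intro sum.cong) (auto simp: mangoldt_AP_def)
  also have "\<dots> = (\<Sum>m\<le>u. mangoldt_AP q a m)"
    by (rule sum.mono_neutral_left) (auto simp: mangoldt_AP_def Suc_le_eq intro: gr0I)
  finally show ?thesis .
qed

text \<open>Only the class \<open>a\<close> of \<open>m\<close> contributes, and
  \<open>q - a\<close> represents \<open>-a\<close>, so the condition on \<open>k\<close> becomes
  \<open>q dvd m + k\<close>.\<close>

lemma sum_mangoldt_AP_pairs: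
  assumes "q > 1" "coprime m q"
  shows "(\<Sum>a\<in>totatives q. mangoldt_AP q a m * mangoldt_AP q (q - a) k) =
     mangoldt m * (if q dvd m + k then mangoldt k else 0)"
proof -
  define b where "b = m mod q"
  have c: "coprime b q" using assms by (simp add: b_def)
  then have "b \<noteq> 0" using assms(1) by (intro notI) simp
  with c assms(1) have b: "b \<in> totatives q" by (auto simp: totatives_def b_def less_imp_le)
  have bq: "b < q" using assms(1) by (simp add: b_def)
  have "(\<Sum>a\<in>totatives q. mangoldt_AP q a m * mangoldt_AP q (q - a) k) =
      (\<Sum>a\<in>{b}. mangoldt_AP q a m * mangoldt_AP q (q - a) k)"
    using b totatives_less[OF _ assms(1)]
    by (intro sum.mono_neutral_right) (auto simp: mangoldt_AP_def cong_def b_def)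
  also have "\<dots> = mangoldt m * mangoldt_AP q (q - b) k"
    by (simp add: mangoldt_AP_def b_def cong_def)
  also have "[k = q - b] (mod q) \<longleftrightarrow> q dvd m + k"
  proof -
    have "[k = q - b] (mod q) \<longleftrightarrow> [b + k = b + (q - b)] (mod q)"
      by (simp add: cong_add_lcancel_nat)
    also have "\<dots> \<longleftrightarrow> [b + k = 0] (mod q)" using bq by (simp add: cong_def)
    also have "\<dots> \<longleftrightarrow> [m + k = 0] (mod q)" by (simp add: cong_def b_def mod_add_left_eq)
    finally show ?thesis by (simp add: cong_0_iff)
  qed
  then have "mangoldt_AP q (q - b) k = (if q dvd m + k then mangoldt k else 0)"
    by (simp add: mangoldt_AP_def)
  finally show ?thesis .
qed

text \<open>The pairs with \<open>q dvd m + k\<close> and \<open>m\<close> prime to \<open>q\<close>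
  are sorted by the class of \<open>m\<close> and make up \<open>S\<close>. The remaining
  \<open>m\<close> have weight at most \<open>q * ln N\<close>, their partners at most
  \<open>N * ln N\<close>.\<close>

lemma sum_psi2_multiples:
  assumes "q > 1" "N > 0"
  defines "G \<equiv> (\<Sum>n\<le>N. if q dvd n then psi2 n else 0)"
    and "S \<equiv> (\<Sum>a\<in>totatives q. \<Sum>m\<le>N. mangoldt_AP q a m * (\<Sum>k\<le>N - m. mangoldt_AP q (q - a) k))"
  shows "S \<le> G" "G \<le> S + real q * real N * (ln (real N))\<^sup>2"
proof -
  let ?h = "\<lambda>m k. mangoldt m * (if q dvd m + k then mangoldt k else 0) :: real"
  have hn: "0 \<le> ?h m k" for m k by (simp add: mangoldt_nonneg)
  have "G = (\<Sum>n\<le>N. \<Sum>m\<le>n. ?h m (n - m))"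
    unfolding G_def psi2_eq by (intro sum.cong) auto
  also have "\<dots> = (\<Sum>m\<le>N. \<Sum>k\<le>N - m. ?h m k)" by (rule sum_diagonals)
  also have "\<dots> = (\<Sum>m\<le>N. (if coprime m q then \<Sum>k\<le>N - m. ?h m k else 0)
      + (if coprime m q then 0 else \<Sum>k\<le>N - m. ?h m k))"
    by (intro sum.cong) auto
  also have "\<dots> = (\<Sum>m\<le>N. if coprime m q then \<Sum>k\<le>N - m. ?h m k else 0) +
      (\<Sum>m\<le>N. if coprime m q then 0 else \<Sum>k\<le>N - m. ?h m k)"
    by (rule sum.distrib)
  also have "(\<Sum>m\<le>N. if coprime m q then \<Sum>k\<le>N - m. ?h m k else 0) =
      (\<Sum>m\<le>N. \<Sum>k\<le>N - m. \<Sum>a\<in>totatives q. mangoldt_AP q a m * mangoldt_AP q (q - a) k)"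
  proof (rule sum.cong)
    fix m
    show "(if coprime m q then \<Sum>k\<le>N - m. ?h m k else 0) =
      (\<Sum>k\<le>N - m. \<Sum>a\<in>totatives q. mangoldt_AP q a m * mangoldt_AP q (q - a) k)"
    proof (cases "coprime m q")
      case False
      then have "mangoldt_AP q a m = 0" if "a \<in> totatives q" for a
        using that cong_imp_coprime[of a m q]
        by (auto simp: mangoldt_AP_def totatives_def cong_sym_eq coprime_commute)
      then show ?thesis using False by simp
    qed (simp add: sum_mangoldt_AP_pairs[OF assms(1)])
  qed simp
  also have "\<dots> = S"
    unfolding S_def
    by (simp only: sum.swap[of _ "totatives q"] sum_distrib_left)
  finally have GS: "G = S + (\<Sum>m\<le>N. if coprime m q then 0 else \<Sum>k\<le>N - m. ?h m k)" .
  have "0 \<le> (\<Sum>m\<le>N. if coprime m q then 0 else \<Sum>k\<le>N - m. ?h m k)"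
    using hn by (intro sum_nonneg) (auto intro!: sum_nonneg)
  with GS show "S \<le> G" by simp
  have "(\<Sum>m\<le>N. if coprime m q then 0 else \<Sum>k\<le>N - m. ?h m k)
      \<le> (\<Sum>m\<le>N. (if \<not> coprime m q then mangoldt m else 0) * (\<Sum>k\<le>N. mangoldt k))"
  proof (rule sum_mono)
    fix m
    have "(\<Sum>k\<le>N - m. ?h m k) \<le> (\<Sum>k\<le>N - m. mangoldt m * mangoldt k)"
      by (intro sum_mono) (auto simp: mangoldt_nonneg)
    also have "\<dots> \<le> (\<Sum>k\<le>N. mangoldt m * mangoldt k)"
      by (intro sum_mono2) (auto simp: mangoldt_nonneg)
    finally show "(if coprime m q then 0 else \<Sum>k\<le>N - m. ?h m k)
        \<le> (if \<not> coprime m q then mangoldt m else 0) * (\<Sum>k\<le>N. mangoldt k)"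
      by (simp add: sum_distrib_left)
  qed
  also have "\<dots> = (\<Sum>m | m \<le> N \<and> \<not> coprime m q. mangoldt m) * (\<Sum>k\<le>N. mangoldt k)"
    unfolding sum_distrib_right [symmetric] by (simp add: sum.inter_filter [symmetric])
  also have "\<dots> \<le> (real q * ln (real N)) * (real N * ln (real N))"
    using assms(1,2)
    by (intro mult_mono sum_mangoldt_not_coprime_le sum_mangoldt_le sum_nonneg)
       (auto simp: mangoldt_nonneg)
  finally show "G \<le> S + real q * real N * (ln (real N))\<^sup>2"
    unfolding GS by (simp add: power2_eq_square algebra_simps)
qed

section \<open>The prime number theorem at a fixed scale\<close>

text \<open>Replaces \<open>u\<^sup>\<beta> / \<beta>\<close> by a linear function of \<open>u\<close>; the upper bound is Bernoulli's inequality.\<close>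

lemma powr_divide_minus_bounds:
  fixes t \<beta> :: real
  assumes "0 \<le> t" "t \<le> 1" "0 < \<beta>" "\<beta> \<le> 1"
  shows "0 \<le> t powr \<beta> / \<beta> - t" "t powr \<beta> / \<beta> - t \<le> 1 / \<beta> - 1"
proof -
  have lo: "t \<le> t powr \<beta>" and up: "t powr \<beta> \<le> (1 - \<beta>) + \<beta> * t"
  proof -
    have "t powr 1 \<le> t powr \<beta>" if "t > 0" using that assms by (intro powr_mono') auto
    then show "t \<le> t powr \<beta>" using assms by (cases "t = 0") auto
    have "exp ((1 - \<beta>) *\<^sub>R 0 + \<beta> *\<^sub>R ln t) \<le> (1 - \<beta>) * exp 0 + \<beta> * exp (ln t)" if "t > 0"
      using assms by (intro convex_onD[OF exp_convex]) auto
    then show "t powr \<beta> \<le> (1 - \<beta>) + \<beta> * t"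
      using assms by (cases "t = 0") (auto simp: powr_def)
  qed
  have "t * \<beta> \<le> t" using assms by (simp add: mult_left_le)
  then show "0 \<le> t powr \<beta> / \<beta> - t" using lo assms(3) by (simp add: field_simps)
  have "t powr \<beta> / \<beta> \<le> ((1 - \<beta>) + \<beta> * t) / \<beta>"
    using up assms(3) by (intro divide_right_mono) auto
  also have "\<dots> = 1 / \<beta> - 1 + t" using assms(3) by (simp add: field_simps)
  finally show "t powr \<beta> / \<beta> - t \<le> 1 / \<beta> - 1" by simp
qed

text \<open>With \<open>v = sqrt (ln u)\<close> and \<open>w = sqrt (ln x)\<close> the exponents
  differ by \<open>(w - v) * (w + v - c)\<close>, which is nonnegative once
  \<open>c \<le> w\<close>. Thus the error term at the top of the range bounds all earlier
  ones.\<close>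

lemma exp_sqrt_ln_mono:
  fixes u x c :: real
  assumes "1 \<le> u" "u \<le> x" "0 \<le> c" "c \<le> sqrt (ln x)"
  shows "u * exp (- c * sqrt (ln u)) \<le> x * exp (- c * sqrt (ln x))"
proof -
  define v w where "v = sqrt (ln u)" and "w = sqrt (ln x)"
  have vw: "0 \<le> v" "v \<le> w" using assms by (auto simp: v_def w_def)
  have sq: "v\<^sup>2 = ln u" "w\<^sup>2 = ln x" using assms by (auto simp: v_def w_def)
  have "(w - v) * (w + v - c) \<ge> 0"
    using vw assms(4) by (intro mult_nonneg_nonneg) (auto simp: w_def)
  then have "v\<^sup>2 + - c * v \<le> w\<^sup>2 + - c * w" by (simp add: power2_eq_square algebra_simps)
  then have "exp (ln u + - c * v) \<le> exp (ln x + - c * w)" unfolding sq by simp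
  then show ?thesis unfolding exp_add using assms by (simp add: v_def w_def)
qed

lemma psi_AP_nonneg: "0 \<le> psi_AP x q a"
  unfolding psi_AP_def by (intro sum_nonneg mangoldt_nonneg)

text \<open>An exponent above 1 would let the secondary term outgrow \<open>x\<close> and make
  \<open>psi_AP\<close> negative. The character value is taken to be 1, as for the class of
  1.\<close>

lemma exceptional_exponent_le_1:
  fixes \<phi> K c \<beta> :: real
  assumes "\<phi> > 0" "c \<ge> 0"
    and PNT: "\<And>x. x \<ge> 2 \<Longrightarrow> \<bar>psi_AP x q a - (x / \<phi> - x powr \<beta> / (\<phi> * \<beta>))\<bar>
                \<le> K * (x * exp (- c * sqrt (ln x)))"
  shows "\<beta> \<le> 1"
proof (rule ccontr)
  assume "\<not> \<beta> \<le> 1"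
  then have \<beta>: "\<beta> > 1" by simp
  have bound: "x powr (\<beta> - 1) \<le> \<beta> * (1 + \<phi> * \<bar>K\<bar>)" if x: "x \<ge> 2" for x
  proof -
    have "K * (x * exp (- c * sqrt (ln x))) \<le> \<bar>K\<bar> * (x * 1)"
      using x assms(2) by (intro mult_mono) auto
    with PNT[OF x] psi_AP_nonneg[of x q a] have "x powr \<beta> / (\<phi> * \<beta>) \<le> x / \<phi> + \<bar>K\<bar> * x" by simp
    then have "x powr \<beta> \<le> (x / \<phi> + \<bar>K\<bar> * x) * (\<phi> * \<beta>)"
      using assms(1) \<beta> by (simp add: pos_divide_le_eq)
    also have "\<dots> = x * (\<beta> * (1 + \<phi> * \<bar>K\<bar>))" using assms(1) by (simp add: field_simps)
    finally show ?thesis using x by (simp add: powr_diff field_simps)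
  qed
  have "filterlim (\<lambda>x::real. x powr (\<beta> - 1)) at_top at_top"
    using \<beta> by real_asymp
  then have "\<forall>\<^sub>F x in at_top. x powr (\<beta> - 1) > \<beta> * (1 + \<phi> * \<bar>K\<bar>)"
    by (simp add: filterlim_at_top_dense)
  then have "\<forall>\<^sub>F x in at_top. x powr (\<beta> - 1) > \<beta> * (1 + \<phi> * \<bar>K\<bar>) \<and> x \<ge> (2::real)"
    using eventually_ge_at_top by (rule eventually_conj)
  then obtain x :: real where "x powr (\<beta> - 1) > \<beta> * (1 + \<phi> * \<bar>K\<bar>)" "x \<ge> 2"
    using eventually_happens'[OF trivial_limit_at_top_linorder] by blast
  with bound show False by fastforce
qed

text \<open>For \<open>\<beta>\<close> close to 1 the secondary term is nearly linear in
  \<open>u\<close>, with the slope \<open>Y\<close> read off at \<open>N\<close>. One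
  \<open>\<epsilon> * N / \<phi>\<close> pays for this linearization and one for the error term;
  partial summation needs the bound for all \<open>u \<le> N\<close>.\<close>

lemma psi_AP_uniform:
  fixes \<phi> K c \<beta> \<epsilon> \<xi> Y :: real and N u :: nat
  assumes "\<phi> > 0" "0 \<le> c" "c \<le> sqrt (ln (real N))" "0 \<le> K" "K * exp (- c * sqrt (ln (real N))) \<le> \<epsilon> / \<phi>"
    and \<beta>: "0 < \<beta>" "\<beta> \<le> 1" "1 / \<beta> - 1 \<le> \<epsilon>" and "1 \<le> \<epsilon> * real N" "\<bar>\<xi>\<bar> \<le> 1"
    and PNT: "\<And>x. x \<ge> 2 \<Longrightarrow> \<bar>psi_AP x q a - (x / \<phi> - \<xi> * x powr \<beta> / (\<phi> * \<beta>))\<bar>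
                \<le> K * (x * exp (- c * sqrt (ln x)))"
    and "u \<le> N"
  defines "Y \<equiv> real N powr (\<beta> - 1)"
  shows "\<bar>psi_AP (real u) q a - (1 - \<xi> * Y) / \<phi> * real u\<bar> \<le> 2 * \<epsilon> * real N / \<phi>"
proof -
  have N: "real N \<ge> 1" using assms(9) by (cases N) auto
  have Y: "0 \<le> Y" "Y \<le> 1"
    using N \<beta> powr_mono[of "\<beta> - 1" 0 "real N"] by (auto simp: Y_def)
  show ?thesis
  proof (cases "u \<ge> 2")
    case False
    \<comment> \<open>Below the range of the prime number theorem \<open>psi_AP\<close> vanishes,
      and the main term, at most \<open>2 / \<phi>\<close>, is absorbed by
      \<open>1 \<le> \<epsilon> * N\<close>.\<close>
    then have "u = 0 \<or> u = 1" by auto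
    then have "psi_AP (real u) q a = 0" 
      unfolding psi_AP_eq by (intro sum.neutral) (auto simp: mangoldt_AP_def le_Suc_eq)
    moreover have "\<bar>(1 - \<xi> * Y) / \<phi> * real u\<bar> \<le> 2 * \<epsilon> * real N / \<phi>"
    proof -
      have "\<bar>\<xi> * Y\<bar> \<le> 1 * 1" unfolding abs_mult using assms(10) Y by (intro mult_mono) auto
      then have "\<bar>1 - \<xi> * Y\<bar> * real u \<le> 2 * 1"
        using \<open>u = 0 \<or> u = 1\<close> by auto
      then have "\<bar>1 - \<xi> * Y\<bar> * real u \<le> 2 * \<epsilon> * real N" using assms(9) by simp
      then show ?thesis using assms(1) by (simp add: abs_mult divide_right_mono)
    qed
    ultimately show ?thesis by simp
  next
    case True
    define t where "t = real u / real N"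
    have t: "0 \<le> t" "t \<le> 1" using N \<open>u \<le> N\<close> by (auto simp: t_def)
    have ut: "real u = real N * t" using N by (simp add: t_def)
    \<comment> \<open>Both terms share a factor:
      \<open>u powr \<beta> = N powr \<beta> * t powr \<beta>\<close> and
      \<open>Y * u = N powr \<beta> * t\<close>.\<close>
    have eq: "real u powr \<beta> / \<beta> - Y * real u = real N powr \<beta> * (t powr \<beta> / \<beta> - t)"
      using N t by (simp add: ut powr_mult Y_def powr_diff algebra_simps)
    have "real N powr \<beta> \<le> real N powr 1" using N \<beta> by (intro powr_mono) auto
    then have "\<bar>real u powr \<beta> / \<beta> - Y * real u\<bar> \<le> real N * \<epsilon>"
      unfolding eq abs_mult using powr_divide_minus_bounds[OF t \<beta>(1,2)] \<beta>(3) N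
      by (intro mult_mono) auto
    then have "\<bar>\<xi> * (real u powr \<beta> / \<beta> - Y * real u)\<bar> \<le> 1 * (real N * \<epsilon>)"
      unfolding abs_mult using assms(10) by (intro mult_mono) auto
    then have "\<bar>\<xi> * (real u powr \<beta> / \<beta> - Y * real u) / \<phi>\<bar> \<le> real N * \<epsilon> / \<phi>"
      using assms(1) by (simp add: divide_right_mono)
    moreover have "(real u / \<phi> - \<xi> * real u powr \<beta> / (\<phi> * \<beta>)) - (1 - \<xi> * Y) / \<phi> * real u
        = - (\<xi> * (real u powr \<beta> / \<beta> - Y * real u) / \<phi>)"
      using assms(1) \<beta>(1) by (simp add: field_simps)
    moreover have "\<bar>psi_AP (real u) q a - (real u / \<phi> - \<xi> * real u powr \<beta> / (\<phi> * \<beta>))\<bar> \<le> real N * \<epsilon> / \<phi>"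
    proof -
      have "\<bar>psi_AP (real u) q a - (real u / \<phi> - \<xi> * real u powr \<beta> / (\<phi> * \<beta>))\<bar>
          \<le> K * (real u * exp (- c * sqrt (ln (real u))))"
        using True by (intro PNT) auto
      also have "\<dots> \<le> K * (real N * exp (- c * sqrt (ln (real N))))"
        using True \<open>u \<le> N\<close> assms(2,3,4) by (intro mult_left_mono exp_sqrt_ln_mono) auto
      also have "\<dots> = real N * (K * exp (- c * sqrt (ln (real N))))" by simp
      also have "\<dots> \<le> real N * (\<epsilon> / \<phi>)" using assms(5) by (intro mult_left_mono) auto
      finally show ?thesis by simp
    qed
    moreover have "2 * \<epsilon> * real N / \<phi> = real N * \<epsilon> / \<phi> + real N * \<epsilon> / \<phi>"
      by (simp add: mult_ac)
    ultimately show ?thesis by argo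
  qed
qed

section \<open>Asymptotic inequalities behind the choice of \<open>N\<close>\<close>

text \<open>\<open>L\<close> stands for \<open>ln q\<close>, \<open>exp ((L / d)^2)\<close> for
  \<open>N\<close> before rounding up, the \<open>+ 1\<close> for the effect of rounding on
  \<open>ln N\<close>, and \<open>\<kappa> / L^2\<close> for the distance of the zero from 1. Since
  \<open>d < c\<close>, the prime number theorem error beats
  \<open>1 / q = exp (- L)\<close>.\<close>

lemma eventually_scale:
  fixes d c \<epsilon> K C \<kappa> c\<^sub>0 y :: real
  assumes "0 < d" "d < c" "0 < \<epsilon>" "0 < \<kappa>" "0 < c\<^sub>0" "y < exp (- \<kappa> / d\<^sup>2)"
  shows "\<forall>\<^sub>F L in at_top. c \<le> L / d" (is ?A)
    and "\<forall>\<^sub>F L in at_top. K * exp (- c * (L / d)) \<le> \<epsilon> * exp (- L)"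
    and "\<forall>\<^sub>F L in at_top. 1 \<le> \<epsilon> * exp ((L / d)\<^sup>2)"
    and "\<forall>\<^sub>F L in at_top. exp (2 * L) * ((L / d)\<^sup>2 + 1)\<^sup>2 \<le> \<epsilon> * exp ((L / d)\<^sup>2)"
    and "\<forall>\<^sub>F L in at_top. C * exp L \<le> \<epsilon> * exp ((L / d)\<^sup>2)"
    and "\<forall>\<^sub>F L in at_top. y \<le> exp (- (\<kappa> / L\<^sup>2) * ((L / d)\<^sup>2 + 1))"
    and "\<forall>\<^sub>F L in at_top. 1 / (1 - \<kappa> / L\<^sup>2) - 1 \<le> \<epsilon>"
    and "\<forall>\<^sub>F L in at_top. \<kappa> / L\<^sup>2 < 1"
    and "\<forall>\<^sub>F L in at_top. \<kappa> / L\<^sup>2 < c\<^sub>0 / L"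
proof -
  show ?A using assms by real_asymp
  show "\<forall>\<^sub>F L in at_top. 1 \<le> \<epsilon> * exp ((L / d)\<^sup>2)" using assms by real_asymp
  show "\<forall>\<^sub>F L in at_top. exp (2 * L) * ((L / d)\<^sup>2 + 1)\<^sup>2 \<le> \<epsilon> * exp ((L / d)\<^sup>2)" using assms by real_asymp
  show "\<forall>\<^sub>F L in at_top. 1 / (1 - \<kappa> / L\<^sup>2) - 1 \<le> \<epsilon>" using assms by real_asymp
  show "\<forall>\<^sub>F L in at_top. \<kappa> / L\<^sup>2 < 1" using assms by real_asymp
  show "\<forall>\<^sub>F L in at_top. \<kappa> / L\<^sup>2 < c\<^sub>0 / L" using assms by real_asymp
  have cd: "c / d > 1" using assms by simp
  \<comment> \<open>The surplus in the exponent after \<open>exp (- L)\<close> has been split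
    off.\<close>
  define r where "r = c / d - 1"
  have r: "r > 0" using cd by (simp add: r_def)
  have "((\<lambda>L::real. K * exp (- r * L)) \<longlongrightarrow> 0) at_top" using r by real_asymp
  then have "\<forall>\<^sub>F L in at_top. K * exp (- r * L) < \<epsilon>"
    using assms(3) by (rule order_tendstoD)
  then show "\<forall>\<^sub>F L in at_top. K * exp (- c * (L / d)) \<le> \<epsilon> * exp (- L)"
  proof eventually_elim
    case (elim L)
    have "K * exp (- c * (L / d)) = K * exp (- r * L) * exp (- L)"
      by (simp add: r_def algebra_simps flip: exp_add)
    also have "\<dots> \<le> \<epsilon> * exp (- L)" using elim by (intro mult_right_mono) auto
    finally show ?case .
  qed
  have "((\<lambda>L::real. C * (exp L / exp ((L / d)\<^sup>2))) \<longlongrightarrow> C * 0) at_top"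
    by (intro tendsto_mult tendsto_const) (use assms in real_asymp)
  then have "\<forall>\<^sub>F L in at_top. C * (exp L / exp ((L / d)\<^sup>2)) < \<epsilon>"
    using assms(3) by (intro order_tendstoD) auto
  then show "\<forall>\<^sub>F L in at_top. C * exp L \<le> \<epsilon> * exp ((L / d)\<^sup>2)"
    by eventually_elim (simp add: field_simps)
  have "((\<lambda>L::real. - (\<kappa> / L\<^sup>2) * ((L / d)\<^sup>2 + 1)) \<longlongrightarrow> - (\<kappa> * (inverse d)\<^sup>2)) at_top"
    using assms by real_asymp
  also have "- (\<kappa> * (inverse d)\<^sup>2) = - \<kappa> / d\<^sup>2"
    by (simp add: field_simps)
  finally have "((\<lambda>L::real. exp (- (\<kappa> / L\<^sup>2) * ((L / d)\<^sup>2 + 1))) \<longlongrightarrow> exp (- \<kappa> / d\<^sup>2)) at_top"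
    by (rule tendsto_exp)
  from order_tendstoD(1)[OF this assms(6)]
  show "\<forall>\<^sub>F L in at_top. y \<le> exp (- (\<kappa> / L\<^sup>2) * ((L / d)\<^sup>2 + 1))"
    by eventually_elim simp
qed

section \<open>The contradiction at a fixed scale\<close>

text \<open>The convolution estimate is applied to each pair of classes \<open>a\<close> and
  \<open>q - a\<close> with densities \<open>\<alpha> a\<close> and \<open>\<alpha> (q - a)\<close>.
  Relative to \<open>N^2 / (2 * \<phi>)\<close> these errors add up to
  \<open>28 * \<epsilon>\<close>, and the \<open>m\<close> not prime to \<open>q\<close> add
  \<open>2 * \<epsilon>\<close>.\<close>

lemma sum_psi2_multiples_approx:
  fixes \<phi> K c \<beta> \<epsilon> Y :: real and q N :: nat
  defines "\<phi> \<equiv> real (totient q)"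
  assumes X: "real_dirichlet_character q X" and q: "q > 1"
  assumes PNT_assms: "0 \<le> c" "c \<le> sqrt (ln (real N))" "0 \<le> K"
    "K * exp (- c * sqrt (ln (real N))) \<le> \<epsilon> / \<phi>"
    and \<beta>: "0 < \<beta>" "\<beta> \<le> 1" "1 / \<beta> - 1 \<le> \<epsilon>" and \<epsilon>: "1 \<le> \<epsilon> * real N" "\<epsilon> \<le> 1"
    and ln: "(real q)\<^sup>2 * (ln (real N))\<^sup>2 \<le> \<epsilon> * real N"
    and PNT: "\<And>x a. x \<ge> 2 \<Longrightarrow> coprime a q \<Longrightarrow>
        \<bar>psi_AP x q a - (x / \<phi> - Re (X a) * x powr \<beta> / (\<phi> * \<beta>))\<bar>
          \<le> K * (x * exp (- c * sqrt (ln x)))"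
  defines "Y \<equiv> real N powr (\<beta> - 1)"
  obtains \<rho> \<sigma> :: real where "(\<rho>, \<sigma>) \<in> {(0, 1), (0, -1), (1, 1)}"
    "\<bar>(\<Sum>n\<le>N. if q dvd n then psi2 n else 0) - (real N)\<^sup>2 / (2 * \<phi>) * (1 - 2 * \<rho> * Y + \<sigma> * Y\<^sup>2)\<bar>
       \<le> (real N)\<^sup>2 / (2 * \<phi>) * (30 * \<epsilon>)"
proof -
  have \<phi>: "\<phi> > 0" using q by (simp add: \<phi>_def)
  have \<phi>q: "\<phi> \<le> real q" by (simp add: \<phi>_def totient_le)
  have N: "N > 0" using \<epsilon>(1) by (cases N) auto
  have \<epsilon>0: "\<epsilon> > 0" using \<epsilon>(1) N by (smt (verit) mult_nonpos_nonneg of_nat_0_le_iff)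
  have Y: "0 \<le> Y" "Y \<le> 1"
    using N \<beta> powr_mono[of "\<beta> - 1" 0 "real N"] by (auto simp: Y_def)
  obtain \<rho> \<sigma> :: real where \<rho>\<sigma>: "(\<rho>, \<sigma>) \<in> {(0, 1), (0, -1), (1, 1)}"
    and W: "(\<Sum>a\<in>totatives q. (1 - Re (X a) * Y) * (1 - Re (X (q - a)) * Y)) =
       \<phi> * (1 - 2 * \<rho> * Y + \<sigma> * Y\<^sup>2)"
    unfolding \<phi>_def by (rule sum_character_pairs[OF X q]) blast
  define \<alpha> where "\<alpha> a = (1 - Re (X a) * Y) / \<phi>" for a
  have val: "Re (X a) = 1 \<or> Re (X a) = -1" if "a \<in> totatives q" for a
    using that by (intro real_character_values[OF X]) (simp add: totatives_def)
  have \<alpha>: "0 \<le> \<alpha> a" "\<alpha> a \<le> 2 / \<phi>" if "a \<in> totatives q" for a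
    using val[OF that] Y \<phi> by (auto simp: \<alpha>_def divide_right_mono)
  have approx: "\<bar>(\<Sum>m\<le>u. mangoldt_AP q a m) - \<alpha> a * real u\<bar> \<le> 2 * \<epsilon> * real N / \<phi>"
    if a: "a \<in> totatives q" and u: "u \<le> N" for a u
  proof -
    have "\<bar>Re (X a)\<bar> \<le> 1" using val[OF a] by auto
    moreover have "coprime a q" using a by (simp add: totatives_def)
    ultimately show ?thesis
      unfolding psi_AP_eq [symmetric] \<alpha>_def Y_def
      using PNT_assms \<phi> \<beta> \<epsilon>(1) PNT u by (intro psi_AP_uniform[where K = K and c = c])
  qed
  define S where "S a = (\<Sum>m\<le>N. mangoldt_AP q a m * (\<Sum>k\<le>N - m. mangoldt_AP q (q - a) k))" for a
  have S: "\<bar>S a - \<alpha> a * \<alpha> (q - a) * (real N)\<^sup>2 / 2\<bar> \<le> 14 * \<epsilon> * (real N)\<^sup>2 / \<phi>\<^sup>2"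
    if a: "a \<in> totatives q" for a
  proof -
    have a': "q - a \<in> totatives q" using q a by (rule minus_in_totatives)
    have e: "0 \<le> 2 * \<epsilon> * real N / \<phi>" using \<epsilon>0 \<phi> by simp
    have "\<bar>S a - \<alpha> a * \<alpha> (q - a) * (real N)\<^sup>2 / 2\<bar>
       \<le> \<alpha> (q - a) * (\<alpha> a * real N / 2 + real N * (2 * \<epsilon> * real N / \<phi>))
           + 2 * \<epsilon> * real N / \<phi> * (\<alpha> a * real N + 2 * \<epsilon> * real N / \<phi>)"
      unfolding S_def
      by (intro sum_convolution_approx mangoldt_AP_nonneg \<alpha> a a' approx e)
    also have "\<dots> \<le> 2 / \<phi> * (2 / \<phi> * real N / 2 + real N * (2 * \<epsilon> * real N / \<phi>))
           + 2 * \<epsilon> * real N / \<phi> * (2 / \<phi> * real N + 2 * \<epsilon> * real N / \<phi>)"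
    proof -
      have 1: "\<alpha> a * real N \<le> 2 / \<phi> * real N" using \<alpha>[OF a] by (intro mult_right_mono) auto
      have 2: "0 \<le> \<alpha> a * real N / 2 + real N * (2 * \<epsilon> * real N / \<phi>)"
        using \<alpha>[OF a] \<epsilon>0 \<phi> by simp
      show ?thesis
      proof (rule add_mono)
        show "\<alpha> (q - a) * (\<alpha> a * real N / 2 + real N * (2 * \<epsilon> * real N / \<phi>))
            \<le> 2 / \<phi> * (2 / \<phi> * real N / 2 + real N * (2 * \<epsilon> * real N / \<phi>))"
          by (rule mult_mono) (use 1 2 \<alpha>[OF a'] \<phi> in \<open>auto simp: mult.commute\<close>)
        show "2 * \<epsilon> * real N / \<phi> * (\<alpha> a * real N + 2 * \<epsilon> * real N / \<phi>)
            \<le> 2 * \<epsilon> * real N / \<phi> * (2 / \<phi> * real N + 2 * \<epsilon> * real N / \<phi>)"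
          by (rule mult_left_mono) (use 1 e in auto)
      qed
    qed
    also have "\<dots> = real N * (2 + 8 * (\<epsilon> * real N) + 4 * \<epsilon> * (\<epsilon> * real N)) / \<phi>\<^sup>2"
      using \<phi> by (simp add: field_simps power2_eq_square)
    \<comment> \<open>\<open>14 = 2 + 8 + 4\<close>, using \<open>1 \<le> \<epsilon> * N\<close> for
      the first term and \<open>\<epsilon> \<le> 1\<close> for the last.\<close>
    also have "\<dots> \<le> real N * (14 * (\<epsilon> * real N)) / \<phi>\<^sup>2"
    proof (intro divide_right_mono mult_left_mono)
      have "\<epsilon> * (\<epsilon> * real N) \<le> 1 * (\<epsilon> * real N)" using \<epsilon> by (intro mult_right_mono) auto
      then show "2 + 8 * (\<epsilon> * real N) + 4 * \<epsilon> * (\<epsilon> * real N) \<le> 14 * (\<epsilon> * real N)"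
        using \<epsilon>(1) by simp
    qed auto
    finally show ?thesis by (simp add: power2_eq_square mult_ac)
  qed
  have "\<bar>\<Sum>a\<in>totatives q. S a - \<alpha> a * \<alpha> (q - a) * (real N)\<^sup>2 / 2\<bar>
      \<le> (\<Sum>a\<in>totatives q. 14 * \<epsilon> * (real N)\<^sup>2 / \<phi>\<^sup>2)"
    by (rule order.trans[OF sum_abs sum_mono]) (rule S)
  also have "\<dots> = (real N)\<^sup>2 / (2 * \<phi>) * (28 * \<epsilon>)"
    using \<phi> by (simp add: totient_def [symmetric] \<phi>_def [symmetric] field_simps power2_eq_square)
  finally have "\<bar>(\<Sum>a\<in>totatives q. S a) - (\<Sum>a\<in>totatives q. \<alpha> a * \<alpha> (q - a) * (real N)\<^sup>2 / 2)\<bar>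
      \<le> (real N)\<^sup>2 / (2 * \<phi>) * (28 * \<epsilon>)" by (simp add: sum_subtractf)
  also have "(\<Sum>a\<in>totatives q. \<alpha> a * \<alpha> (q - a) * (real N)\<^sup>2 / 2) =
      (real N)\<^sup>2 / (2 * \<phi>\<^sup>2) * (\<Sum>a\<in>totatives q. (1 - Re (X a) * Y) * (1 - Re (X (q - a)) * Y))"
    unfolding sum_distrib_left by (intro sum.cong) (auto simp: \<alpha>_def power2_eq_square mult_ac)
  also have "\<dots> = (real N)\<^sup>2 / (2 * \<phi>) * (1 - 2 * \<rho> * Y + \<sigma> * Y\<^sup>2)"
    unfolding W using \<phi> by (simp add: power2_eq_square)
  finally have main: "\<bar>(\<Sum>a\<in>totatives q. S a) - (real N)\<^sup>2 / (2 * \<phi>) * (1 - 2 * \<rho> * Y + \<sigma> * Y\<^sup>2)\<bar>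
      \<le> (real N)\<^sup>2 / (2 * \<phi>) * (28 * \<epsilon>)" .
  have "real q * real N * (ln (real N))\<^sup>2 \<le> (real N)\<^sup>2 / (2 * \<phi>) * (2 * \<epsilon>)"
  proof -
    have "\<phi> * (real q * (ln (real N))\<^sup>2) \<le> real q * (real q * (ln (real N))\<^sup>2)"
      using \<phi>q by (intro mult_right_mono) auto
    also have "\<dots> \<le> \<epsilon> * real N" using ln by (simp add: power2_eq_square mult_ac)
    finally have "real N * (\<phi> * (real q * (ln (real N))\<^sup>2)) \<le> real N * (\<epsilon> * real N)"
      by (intro mult_left_mono) auto
    then show ?thesis using \<phi> by (simp add: field_simps power2_eq_square)
  qed
  with sum_psi2_multiples[OF q N] main have
    "\<bar>(\<Sum>n\<le>N. if q dvd n then psi2 n else 0) - (real N)\<^sup>2 / (2 * \<phi>) * (1 - 2 * \<rho> * Y + \<sigma> * Y\<^sup>2)\<bar>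
       \<le> (real N)\<^sup>2 / (2 * \<phi>) * (28 * \<epsilon>) + (real N)\<^sup>2 / (2 * \<phi>) * (2 * \<epsilon>)"
    unfolding S_def abs_le_iff by linarith
  also have "\<dots> = (real N)\<^sup>2 / (2 * \<phi>) * (30 * \<epsilon>)"
    unfolding distrib_left [symmetric] by simp
  finally show thesis using \<rho>\<sigma> that by blast
qed

text \<open>Summing the conjecture over the multiples of \<open>q\<close> confines
  \<open>G / B\<close> to the range from \<open>\<delta>\<close> to \<open>2 - \<delta>\<close> up
  to \<open>O(\<epsilon>)\<close>, while the prime number theorem evaluates it in terms of
  \<open>Y\<close>. The lower bound \<open>y\<close> for \<open>Y\<close> is too large for that
  range.\<close>

lemma no_exceptional_zero_at_scale:
  fixes \<phi> K c \<beta> \<epsilon> \<delta> C y :: real and q N n\<^sub>0 :: nat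
  defines "\<phi> \<equiv> real (totient q)"
  assumes \<delta>: "0 < \<delta>" "\<delta> < 1"
    and HL: "\<And>n. n \<ge> n\<^sub>0 \<Longrightarrow> even n \<Longrightarrow> \<delta> * singular_series n * real n \<le> psi2 n \<and>
        psi2 n \<le> (2 - \<delta>) * singular_series n * real n"
    and SS: "\<bar>(\<Sum>n\<le>N. (if q dvd n then singular_series n else 0) * real n) - (real N)\<^sup>2 / (2 * \<phi>)\<bar>
      \<le> real N / \<phi> * (1 / 2 + 2 * (\<epsilon> * real N + C * real q))"
    and C: "C * real q \<le> \<epsilon> * real N"
    and X: "real_dirichlet_character q X" and q: "q > 1" "q \<ge> n\<^sub>0"
    and PNT_assms: "0 \<le> c" "c \<le> sqrt (ln (real N))" "0 \<le> K"
      "K * exp (- c * sqrt (ln (real N))) \<le> \<epsilon> / \<phi>"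
    and \<beta>: "0 < \<beta>" "\<beta> \<le> 1" "1 / \<beta> - 1 \<le> \<epsilon>" and \<epsilon>: "1 \<le> \<epsilon> * real N" "\<epsilon> \<le> 1"
    and ln: "(real q)\<^sup>2 * (ln (real N))\<^sup>2 \<le> \<epsilon> * real N"
    and PNT: "\<And>x a. x \<ge> 2 \<Longrightarrow> coprime a q \<Longrightarrow>
        \<bar>psi_AP x q a - (x / \<phi> - Re (X a) * x powr \<beta> / (\<phi> * \<beta>))\<bar>
          \<le> K * (x * exp (- c * sqrt (ln x)))"
    and y: "0 \<le> y" "y \<le> real N powr (\<beta> - 1)" "54 * \<epsilon> < y\<^sup>2 - (1 - \<delta>)"
  shows False
proof -
  define Y where "Y = real N powr (\<beta> - 1)"
  have \<phi>: "\<phi> > 0" using q by (simp add: \<phi>_def)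
  have \<phi>q: "\<phi> \<le> real q" by (simp add: \<phi>_def totient_le)
  have N: "N > 0" using \<epsilon>(1) by (cases N) auto
  have Y: "0 \<le> Y" "Y \<le> 1"
    using N \<beta> powr_mono[of "\<beta> - 1" 0 "real N"] by (auto simp: Y_def)
  have yY: "y\<^sup>2 \<le> Y\<^sup>2" using y(1,2) unfolding Y_def by (intro power_mono)
  define B where "B = (real N)\<^sup>2 / (2 * \<phi>)"
  have B: "B > 0" using N \<phi> by (simp add: B_def)
  define G where "G = (\<Sum>n\<le>N. if q dvd n then psi2 n else 0)"
  define T where "T = (\<Sum>n\<le>N. (if q dvd n then singular_series n else 0) * real n)"
  obtain \<rho> \<sigma> :: real where \<rho>\<sigma>: "(\<rho>, \<sigma>) \<in> {(0, 1), (0, -1), (1, 1)}"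
    and G: "\<bar>G - B * (1 - 2 * \<rho> * Y + \<sigma> * Y\<^sup>2)\<bar> \<le> B * (30 * \<epsilon>)"
    unfolding G_def B_def Y_def \<phi>_def
    by (rule sum_psi2_multiples_approx[OF X q(1) PNT_assms[unfolded \<phi>_def] \<beta> \<epsilon> ln PNT[unfolded \<phi>_def]]) auto
  have T: "\<bar>T - B\<bar> \<le> B * (10 * \<epsilon>)"
  proof -
    have "real N / \<phi> * (1 / 2 + 2 * (\<epsilon> * real N + C * real q)) \<le> real N / \<phi> * (5 * (\<epsilon> * real N))"
      using C \<epsilon>(1) \<phi> by (intro mult_left_mono) auto
    also have "\<dots> = B * (10 * \<epsilon>)" by (simp add: B_def power2_eq_square)
    finally show ?thesis using SS unfolding T_def B_def by linarith
  qed
  define Odd where "Odd = (\<Sum>n\<le>N. if odd n then psi2 n else 0)"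
  have Odd: "Odd \<le> B * (4 * \<epsilon>)"
  proof -
    have "Odd \<le> 2 * real N * (ln (real N))\<^sup>2" unfolding Odd_def using N by (rule sum_psi2_odd_le)
    also have "\<dots> \<le> B * (4 * \<epsilon>)"
    proof -
      have "real q * 1 \<le> real q * real q" using q(1) by (intro mult_left_mono) auto
      then have "\<phi> * (ln (real N))\<^sup>2 \<le> (real q)\<^sup>2 * (ln (real N))\<^sup>2"
        using \<phi>q by (intro mult_right_mono) (auto simp: power2_eq_square)
      then have "real N * (\<phi> * (ln (real N))\<^sup>2) \<le> real N * (\<epsilon> * real N)"
        using ln by (intro mult_left_mono) auto
      then show ?thesis using \<phi> by (simp add: B_def field_simps power2_eq_square)
    qed
    finally show ?thesis .
  qed
  \<comment> \<open>Since \<open>q \<ge> n\<^sub>0\<close>, the conjecture applies to every nonzero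
    even multiple of \<open>q\<close>, with no initial terms to split off.\<close>
  have big: "n = 0 \<or> n \<ge> n\<^sub>0" if "q dvd n" for n
    using that q(2) dvd_imp_le[of q n] by linarith
  have psi20: "psi2 0 = 0" by (simp add: psi2_eq)
  \<comment> \<open>At odd \<open>n\<close> the singular series is 0 and \<open>psi2_nonneg\<close>
    suffices; in the upper bound that follows, \<open>Odd\<close> covers these
    \<open>n\<close>.\<close>
  have "\<delta> * T \<le> G"
    unfolding T_def G_def sum_distrib_left
  proof (rule sum_mono)
    fix n
    show "\<delta> * ((if q dvd n then singular_series n else 0) * real n) \<le> (if q dvd n then psi2 n else 0)"
      using HL[of n] big[of n] psi20 psi2_nonneg[of n]
      by (cases "even n") (auto simp: singular_series_def mult_ac)
  qed
  moreover have "G \<le> (2 - \<delta>) * T + Odd"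
    unfolding T_def G_def Odd_def sum_distrib_left sum.distrib [symmetric]
  proof (rule sum_mono)
    fix n
    show "(if q dvd n then psi2 n else 0)
        \<le> (2 - \<delta>) * ((if q dvd n then singular_series n else 0) * real n) + (if odd n then psi2 n else 0)"
      using HL[of n] big[of n] psi20 psi2_nonneg[of n]
      by (cases "even n") (auto simp: singular_series_def mult_ac)
  qed
  moreover have "\<delta> * (B - B * (10 * \<epsilon>)) \<le> \<delta> * T"
    using T \<delta> by (intro mult_left_mono) auto
  moreover have "(2 - \<delta>) * T \<le> (2 - \<delta>) * (B + B * (10 * \<epsilon>))"
    using T \<delta> by (intro mult_left_mono) auto
  ultimately have "\<delta> * (B - B * (10 * \<epsilon>)) \<le> B * (1 - 2 * \<rho> * Y + \<sigma> * Y\<^sup>2) + B * (30 * \<epsilon>)"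
    and "B * (1 - 2 * \<rho> * Y + \<sigma> * Y\<^sup>2) \<le> (2 - \<delta>) * (B + B * (10 * \<epsilon>)) + B * (4 * \<epsilon>) + B * (30 * \<epsilon>)"
    using G Odd unfolding abs_le_iff by linarith+
  then have "B * (\<delta> * (1 - 10 * \<epsilon>)) \<le> B * ((1 - 2 * \<rho> * Y + \<sigma> * Y\<^sup>2) + 30 * \<epsilon>)"
    and "B * (1 - 2 * \<rho> * Y + \<sigma> * Y\<^sup>2) \<le> B * ((2 - \<delta>) * (1 + 10 * \<epsilon>) + 34 * \<epsilon>)"
    by (simp_all add: algebra_simps)
  then have lower: "\<delta> * (1 - 10 * \<epsilon>) \<le> (1 - 2 * \<rho> * Y + \<sigma> * Y\<^sup>2) + 30 * \<epsilon>"
    and upper: "1 - 2 * \<rho> * Y + \<sigma> * Y\<^sup>2 \<le> (2 - \<delta>) * (1 + 10 * \<epsilon>) + 34 * \<epsilon>"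
    using B by (auto simp: mult_le_cancel_left_pos)
  have "\<epsilon> \<ge> 0" using \<epsilon>(1) N by (smt (verit) mult_nonpos_nonneg of_nat_0_le_iff)
  then have "\<delta> * \<epsilon> \<le> 1 * \<epsilon>" "0 \<le> \<delta> * \<epsilon>" using \<delta> by (auto simp: mult_left_le_one_le)
  \<comment> \<open>The upper bound needs \<open>54 = 20 + 34\<close>, from
    \<open>2 - \<delta> \<le> 2\<close>; the lower one would do with 40.\<close>
  with lower upper have lower': "\<delta> \<le> (1 - 2 * \<rho> * Y + \<sigma> * Y\<^sup>2) + 54 * \<epsilon>"
    and upper': "1 - 2 * \<rho> * Y + \<sigma> * Y\<^sup>2 \<le> 2 - \<delta> + 54 * \<epsilon>"
    using \<open>\<epsilon> \<ge> 0\<close> by (simp_all add: algebra_simps)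
  \<comment> \<open>This gives \<open>(1 - Y)^2 \<le> 1 - Y^2\<close>, so the principal case follows
    from \<open>lower'\<close> like the odd one; the even nonprincipal case uses
    \<open>upper'\<close>.\<close>
  have "Y\<^sup>2 \<le> Y" using Y by (simp add: power2_eq_square mult_left_le)
  with \<rho>\<sigma> lower' upper' y(3) yY show False by auto
qed

section \<open>Choice of the scale and passage to all large moduli\<close>

theorem theorem3:
  fixes \<delta> c c\<^sub>1 c' :: real
  assumes "0 < \<delta>" and "\<delta> < 1"
    and "weak_HL_Goldbach \<delta>"
    and "0 < c"
    and "PNT_AP_const c\<^sub>1"
    and "0 < c'" and "c' < c\<^sub>1"
  shows "\<forall>\<^sub>F q in sequentially. \<forall>X\<^sub>1 \<beta>\<^sub>1.
           real_dirichlet_character q X\<^sub>1 \<longrightarrow>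
           dirichlet_L_zero q X\<^sub>1 (complex_of_real \<beta>\<^sub>1) \<longrightarrow>
           1 - c / ln (real q) < \<beta>\<^sub>1 \<longrightarrow>
           \<beta>\<^sub>1 < 1 - (1 / 2 * c'\<^sup>2 * ln (1 / (1 - \<delta>))) / (ln (real q))\<^sup>2"
proof -
  define \<kappa> where "\<kappa> = 1 / 2 * c'\<^sup>2 * ln (1 / (1 - \<delta>))"
  have "ln (1 / (1 - \<delta>)) > 0" using assms(1,2) by (intro ln_gt_zero) (auto simp: field_simps)
  then have \<kappa>: "\<kappa> > 0" using assms(6) by (simp add: \<kappa>_def)
  \<comment> \<open>Any value strictly between would do: \<open>d < c\<^sub>1\<close> makes the
    prime number theorem error small against \<open>1 / q\<close>, and \<open>c' < d\<close> keeps
    \<open>Y\<close> large.\<close>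
  define d where "d = (c' + c\<^sub>1) / 2"
  have d: "0 < d" "c' < d" "d < c\<^sub>1" using assms(6,7) by (auto simp: d_def)
  \<comment> \<open>\<open>exp (- \<kappa> / d^2)\<close> is the limit of
    \<open>N powr (- \<kappa> / L^2)\<close>, and it exceeds \<open>sqrt (1 - \<delta>)\<close>
    because \<open>c' < d\<close>. A \<open>y\<close> in between does not depend on
    \<open>q\<close>, and hence neither does \<open>\<epsilon>\<close>.\<close>
  obtain y where y: "sqrt (1 - \<delta>) < y" "y < exp (- \<kappa> / d\<^sup>2)"
  proof -
    have "c'\<^sup>2 < d\<^sup>2" using d assms(6) by (intro power_strict_mono) auto
    then have "c'\<^sup>2 * ln (1 / (1 - \<delta>)) < d\<^sup>2 * ln (1 / (1 - \<delta>))"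
      using \<open>ln (1 / (1 - \<delta>)) > 0\<close> by simp
    then have "\<kappa> / d\<^sup>2 < ln (1 / (1 - \<delta>)) / 2"
      using d by (simp add: \<kappa>_def field_simps)
    also have "\<dots> = - ln (1 - \<delta>) / 2" using assms(2) by (simp add: ln_div)
    finally have "exp (ln (1 - \<delta>) / 2) < exp (- \<kappa> / d\<^sup>2)" by simp
    moreover have "sqrt (1 - \<delta>) = exp (ln (1 - \<delta>) / 2)"
      using assms(2) by (intro real_sqrt_unique) (auto simp flip: exp_double)
    ultimately show thesis using that dense by metis
  qed
  have y0: "y > 0" using y(1) assms(2) by (smt (verit) real_sqrt_ge_zero)
  have y2: "1 - \<delta> < y\<^sup>2" using y(1) assms(2) power_strict_mono[of "sqrt (1 - \<delta>)" y 2] by simp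
  \<comment> \<open>Dividing by 55 makes the required bound on \<open>54 * \<epsilon>\<close>
    strict.\<close>
  define \<epsilon> where "\<epsilon> = min 1 ((y\<^sup>2 - (1 - \<delta>)) / 55)"
  have \<epsilon>: "0 < \<epsilon>" "\<epsilon> \<le> 1" "54 * \<epsilon> < y\<^sup>2 - (1 - \<delta>)" using y2 by (auto simp: \<epsilon>_def min_def)
  from assms(5) obtain c\<^sub>0 K where c\<^sub>0: "c\<^sub>0 > 0" and c\<^sub>1: "c\<^sub>1 > 0" and
    PNT: "\<And>x q a X \<beta>. x \<ge> 2 \<Longrightarrow> q > 0 \<Longrightarrow> coprime a q \<Longrightarrow> exceptional_zero c\<^sub>0 q X \<beta> \<Longrightarrow>
       \<bar>psi_AP x q a - (x / real (totient q) - Re (X a) * x powr \<beta> / (real (totient q) * \<beta>))\<bar>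
             \<le> K * (x * exp (- c\<^sub>1 * sqrt (ln x)))"
    unfolding PNT_AP_const_def by metis
  from assms(3) obtain n\<^sub>0 where HL: "\<And>n. n \<ge> n\<^sub>0 \<Longrightarrow> even n \<Longrightarrow>
      \<delta> * singular_series n * real n \<le> psi2 n \<and> psi2 n \<le> (2 - \<delta>) * singular_series n * real n"
    unfolding weak_HL_Goldbach_def eventually_sequentially by blast
  obtain C where C: "\<And>q N. q > 0 \<Longrightarrow>
    \<bar>(\<Sum>n\<le>N. (if q dvd n then singular_series n else 0) * real n) - (real N)\<^sup>2 / (2 * real (totient q))\<bar>
      \<le> real N / real (totient q) * (1 / 2 + 2 * (\<epsilon> * real N + C * real q))"
    using sum_singular_series_multiples[OF \<epsilon>(1,2)] by blast
  have ln_top: "filterlim (\<lambda>q. ln (real q)) at_top sequentially" by real_asymp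
  note scale = eventually_scale[OF d(1,3) \<epsilon>(1) \<kappa> c\<^sub>0 y(2), THEN eventually_compose_filterlim[OF _ ln_top]]
  show ?thesis
    unfolding \<kappa>_def [symmetric]
    using eventually_gt_at_top[of 1] eventually_ge_at_top[of n\<^sub>0]
      scale(1) scale(2)[of "\<bar>K\<bar>"] scale(3,4) scale(5)[of C] scale(6-9)
  proof eventually_elim
    case (elim q)
    define L where "L = ln (real q)"
    define N where "N = nat \<lceil>exp ((L / d)\<^sup>2)\<rceil>"
    note sc = elim(3-11)[folded L_def]
    have L: "L > 0" "exp L = real q" using elim(1) by (auto simp: L_def)
    have expN: "exp ((L / d)\<^sup>2) \<le> real N" unfolding N_def by (rule real_nat_ceiling_ge)
    have exp1: "1 \<le> exp ((L / d)\<^sup>2)" by simp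
    have N1: "real N \<ge> 1" using exp1 expN by (rule order.trans)
    have lnN_ge: "(L / d)\<^sup>2 \<le> ln (real N)" using expN N1 by (subst ln_ge_iff) auto
    have sqrtN: "L / d \<le> sqrt (ln (real N))" using lnN_ge by (rule real_le_rsqrt)
    have lnN_le: "ln (real N) \<le> (L / d)\<^sup>2 + 1"
    proof -
      \<comment> \<open>Rounding up adds at most 1, so at most a factor \<open>exp 1\<close>, and
        \<open>ln N\<close> grows by at most 1.\<close>
      have "real N \<le> exp ((L / d)\<^sup>2) + 1" 
        unfolding N_def using exp1 of_int_ceiling_le_add_one[of "exp ((L / d)\<^sup>2)"] by simp
      also have "\<dots> \<le> exp ((L / d)\<^sup>2) * exp 1"
      proof -
        have "exp ((L / d)\<^sup>2) * 2 \<le> exp ((L / d)\<^sup>2) * exp 1"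
          using exp_ge_add_one_self[of 1] by (intro mult_left_mono) auto
        then show ?thesis using exp1 by linarith
      qed
      finally have "real N \<le> exp ((L / d)\<^sup>2 + 1)" by (simp add: exp_add)
      then show ?thesis using N1 ln_mono[of "real N" "exp ((L / d)\<^sup>2 + 1)"] by simp
    qed
    have \<epsilon>N: "t \<le> \<epsilon> * exp ((L / d)\<^sup>2) \<Longrightarrow> t \<le> \<epsilon> * real N" for t
      using expN \<epsilon>(1) by (meson less_imp_le mult_left_mono order.trans)
    have totq: "0 < real (totient q)" "real (totient q) \<le> real q"
      using elim(1) by (auto simp: totient_le)
    show ?case
      unfolding L_def [symmetric]
    proof (intro allI impI, rule ccontr)
      fix X \<beta>
      assume X: "real_dirichlet_character q X"
        and zero: "dirichlet_L_zero q X (complex_of_real \<beta>)"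
        and "\<not> \<beta> < 1 - \<kappa> / L\<^sup>2"
      then have \<beta>: "1 - \<kappa> / L\<^sup>2 \<le> \<beta>" by simp
      \<comment> \<open>The constant \<open>c\<^sub>0\<close> of the prime number theorem may differ
        from \<open>c\<close>, but a zero this close to 1 is exceptional for it, since eventually
        \<open>\<kappa> / L^2 < c\<^sub>0 / L\<close>.\<close>
      have exc: "exceptional_zero c\<^sub>0 q X \<beta>"
        unfolding exceptional_zero_def L_def [symmetric] using X zero \<beta> sc(9) by auto
      \<comment> \<open>The sign of \<open>K\<close> is unknown and the estimates at the fixed scale
        ask for a nonnegative constant.\<close>
      have PNT': "\<bar>psi_AP x q a - (x / real (totient q) -
            Re (X a) * x powr \<beta> / (real (totient q) * \<beta>))\<bar> \<le> \<bar>K\<bar> * (x * exp (- c\<^sub>1 * sqrt (ln x)))"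
        if "x \<ge> 2" "coprime a q" for x a
      proof (rule order.trans[OF PNT])
        show "K * (x * exp (- c\<^sub>1 * sqrt (ln x))) \<le> \<bar>K\<bar> * (x * exp (- c\<^sub>1 * sqrt (ln x)))"
          using that by (intro mult_right_mono) auto
      qed (use that exc elim(1) in auto)
      have X1: "Re (X 1) = 1" using real_character_one[OF X] .
      have \<beta>1: "\<beta> \<le> 1"
      proof (rule exceptional_exponent_le_1)
        fix x :: real assume "x \<ge> 2"
        from PNT'[OF this, of 1] X1
        show "\<bar>psi_AP x q 1 - (x / real (totient q) - x powr \<beta> / (real (totient q) * \<beta>))\<bar>
            \<le> \<bar>K\<bar> * (x * exp (- c\<^sub>1 * sqrt (ln x)))" by simp
      qed (use totq c\<^sub>1 in auto)
      have \<beta>0: "\<beta> > 0" using \<beta> sc(8) by linarith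
      have "1 / \<beta> \<le> 1 / (1 - \<kappa> / L\<^sup>2)" using \<beta> sc(8) by (intro divide_left_mono) auto
      then have \<beta>\<epsilon>: "1 / \<beta> - 1 \<le> \<epsilon>" using sc(7) by linarith
      have err: "\<bar>K\<bar> * exp (- c\<^sub>1 * sqrt (ln (real N))) \<le> \<epsilon> / real (totient q)"
      proof -
        have "\<bar>K\<bar> * exp (- c\<^sub>1 * sqrt (ln (real N))) \<le> \<bar>K\<bar> * exp (- c\<^sub>1 * (L / d))"
          using mult_left_mono[OF sqrtN, of c\<^sub>1] c\<^sub>1 by (intro mult_left_mono) auto
        also have "\<dots> \<le> \<epsilon> * exp (- L)" by (rule sc(2))
        also have "\<dots> = \<epsilon> / real q" using L(2) by (simp add: exp_minus field_simps)
        also have "\<dots> \<le> \<epsilon> / real (totient q)" using totq \<epsilon>(1) by (intro divide_left_mono) auto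
        finally show ?thesis .
      qed
      have lnq: "(real q)\<^sup>2 * (ln (real N))\<^sup>2 \<le> \<epsilon> * real N"
      proof (rule \<epsilon>N)
        have "(real q)\<^sup>2 * (ln (real N))\<^sup>2 \<le> (real q)\<^sup>2 * ((L / d)\<^sup>2 + 1)\<^sup>2"
          using lnN_le N1 by (intro mult_left_mono power_mono) auto
        also have "\<dots> = exp (2 * L) * ((L / d)\<^sup>2 + 1)\<^sup>2" using L(2) by (simp add: exp_double)
        finally show "(real q)\<^sup>2 * (ln (real N))\<^sup>2 \<le> \<epsilon> * exp ((L / d)\<^sup>2)" using sc(4) by linarith
      qed
      \<comment> \<open>Here \<open>\<beta> - 1 \<ge> - \<kappa> / L^2\<close> and the upper bound
        for \<open>ln N\<close> enter; everything else used that \<open>N\<close> is large.\<close>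
      have yN: "y \<le> real N powr (\<beta> - 1)"
      proof -
        have "\<kappa> / L\<^sup>2 * ln (real N) \<le> \<kappa> / L\<^sup>2 * ((L / d)\<^sup>2 + 1)"
          using lnN_le \<kappa> by (intro mult_left_mono) auto
        moreover have "- (\<kappa> / L\<^sup>2) * ln (real N) \<le> (\<beta> - 1) * ln (real N)"
          using \<beta> N1 by (intro mult_right_mono) auto
        ultimately have "exp (- (\<kappa> / L\<^sup>2) * ((L / d)\<^sup>2 + 1)) \<le> exp ((\<beta> - 1) * ln (real N))"
          by simp
        with sc(6) have "y \<le> exp ((\<beta> - 1) * ln (real N))" by (rule order.trans)
        then show ?thesis using N1 by (simp add: powr_def)
      qed
      show False
      proof (rule no_exceptional_zero_at_scale[OF assms(1,2) HL C _ X elim(1,2) _ _ _ err \<beta>0 \<beta>1 \<beta>\<epsilon> _ \<epsilon>(2)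
            lnq PNT' _ yN \<epsilon>(3)])
        show "C * real q \<le> \<epsilon> * real N" using sc(5) L(2) by (intro \<epsilon>N) simp
        show "1 \<le> \<epsilon> * real N" using sc(3) by (rule \<epsilon>N)
        show "c\<^sub>1 \<le> sqrt (ln (real N))" using sc(1) sqrtN by linarith
      qed (use elim(1) c\<^sub>1 y0 in auto)
    qed
  qed
qed

end
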